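(* Fix $\alpha\in[0,1)$ and $\beta\in(0,1)$, and put $Q=1-\alpha$, $S=1-\beta$. Let $\nu_n^{\alpha,\beta}$ be the stationary law of the count chain of the combined clumsy-careless collector and $\mu_n^{\alpha,\beta}:=\mathbb P_{\nu_n^{\alpha,\beta}}(K_0<n,K_1=n)$. Then $\mu_n^{\alpha,\beta}\sim\frac{1}{(S;S)_\infty}\frac{n!}{n^n}Q^nS^{n(n+1)/2}$. If $T_n^{\alpha,\beta}$ is the first post-thinning completion time from the empty collection, then $\mu_n^{\alpha,\beta}T_n^{\alpha,\beta}\Rightarrow\mathrm{Exp}(1)$, and for every fixed $r\ge1$, $\mathbb E(\mu_n^{\alpha,\beta}T_n^{\alpha,\beta})^r\to r!$. Consequently $\mathbb ET_n^{\alpha,\beta}\sim(S;S)_\infty\frac{n^n}{n!}Q^{-n}S^{-n(n+1)/2}$ and $\mathrm{Var}(T_n^{\alpha,\beta})\sim(S;S)_\infty^2\left(\frac{n^n}{n!}\right)^2Q^{-2n}S^{-n(n+1)}$.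
   Context: Combined clumsy-careless collector on $n$ types: the state is the set of present types, starting from $\emptyset$. In each round one type is drawn uniformly from $[n]$ independently of the past; the selected type is refreshed to present with probability $Q$ and to absent with probability $\alpha$; after this, every currently present coupon is independently retained with probability $S$ (lost with probability $\beta$). Completion is checked after this thinning step: $T_n^{\alpha,\beta}$ is the first round after which all $n$ types are present. $K_t$ is the number of present types after thinning at time $t$; it is a Markov chain on $\{0,\dots,n\}$: given $K_t=k$, with probability $k/n$, $K_{t+1}\sim\mathrm{Bin}(k-1,S)+\mathrm{Bernoulli}(QS)$ and with probability $(n-k)/n$, $K_{t+1}\sim\mathrm{Bin}(k,S)+\mathrm{Bernoulli}(QS)$ (independent summands; the first case is absent when $k=0$). It is irreducible and aperiodic with unique stationary law $\nu_n^{\alpha,\beta}$. $(S;S)_\infty:=\prod_{r=1}^\infty(1-S^r)$. *)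

theory Defs
  imports "HOL-Probability.Probability" "HOL-Library.Landau_Symbols"
begin

text \<open>One-step transition law of the count chain K of the combined clumsy-careless
  collector on n types with refresh-present probability Q and retention probability S:
  given K_t = k, with probability k/n the next state is Bin(k-1,S) + Bernoulli(QS),
  and with probability (n-k)/n it is Bin(k,S) + Bernoulli(QS) (independent summands).\<close>
definition cc_kernel :: "real \<Rightarrow> real \<Rightarrow> nat \<Rightarrow> nat \<Rightarrow> nat pmf" where
  "cc_kernel Q S n k =
     bind_pmf (bernoulli_pmf (real k / real n))
       (\<lambda>b. map_pmf (\<lambda>(x, y). x + (if y then 1 else 0))
              (pair_pmf (binomial_pmf (if b then k - 1 else k) S) (bernoulli_pmf (Q * S))))"

definition cc_stationary :: "real \<Rightarrow> real \<Rightarrow> nat \<Rightarrow> nat pmf \<Rightarrow> bool" where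
  "cc_stationary Q S n \<nu> \<longleftrightarrow> set_pmf \<nu> \<subseteq> {0..n} \<and> bind_pmf \<nu> (cc_kernel Q S n) = \<nu>"

definition cc_nu :: "real \<Rightarrow> real \<Rightarrow> nat \<Rightarrow> nat pmf" where
  "cc_nu Q S n = (THE \<nu>. cc_stationary Q S n \<nu>)"

definition cc_mu :: "real \<Rightarrow> real \<Rightarrow> nat \<Rightarrow> real" where
  "cc_mu Q S n = (\<Sum>k<n. pmf (cc_nu Q S n) k * pmf (cc_kernel Q S n k) n)"

fun cc_hit :: "real \<Rightarrow> real \<Rightarrow> nat \<Rightarrow> nat \<Rightarrow> nat \<Rightarrow> real" where
  "cc_hit Q S n 0 k = 0"
| "cc_hit Q S n (Suc 0) k = pmf (cc_kernel Q S n k) n"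
| "cc_hit Q S n (Suc (Suc t)) k =
     (\<Sum>j<n. pmf (cc_kernel Q S n k) j * cc_hit Q S n (Suc t) j)"

definition cc_T :: "real \<Rightarrow> real \<Rightarrow> nat \<Rightarrow> nat \<Rightarrow> real" where
  "cc_T Q S n t = cc_hit Q S n t 0"

definition qpoch_inf :: "real \<Rightarrow> real" where
  "qpoch_inf S = (\<Prod>r. 1 - S ^ Suc r)"

end

(* The normalised factorial moments phi_m(k) = C(k,m) / C(n,m) are mapped by the transition operator to
   a_m phi_m + c_m phi_(m-1) with a_m + c_m <= S^m.  Hence they relax to the products
   psi_m = prod_(i<=m) c_i / (1 - a_i) at rate S^t, psi_n is the stationary mass of the full state n, and,
   because a_n = 0, the probability of being in state n after t + 1 steps is within S^(n+t) of psi_n from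
   every start.  First-passage decomposition at n therefore gives, for the tail h_t = P(T > t), the nearly
   exact identity h_t + psi_n * sum_(s<t) h_s = 1 + O(S^n) uniformly in t.  A discrete Gronwall
   comparison with (1 - psi_n)^t yields the exponential limit, and repeated summation of the same
   identity yields all rising factorial moments. *)
theory Submission
  imports Defs
begin

text \<open>For small t and large n the error S^(n+t) is far larger than psi_n, which carries the
  factor S^(n(n+1)/2). Single occupation probabilities are therefore never compared with psi_n
  multiplicatively: only their errors summed over t enter, and these are measured against 1. The
  relaxation bound S^t alone would leave an error of constant order, so the gain S^n is essential.
  It is the factor c_n of the last recursion step; a_n vanishes because the selected type always
  belongs to the set of all n types. The gain is needed from the starts 0 and n alike, since the
  decomposition restarts the chain in n. The moments do not come from the weak limit, which would
  require uniform integrability; rising factorials are used because summation by parts raises their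
  order exactly, and they differ from powers only by lower order terms. Stationary balance at n
  gives mu = psi_n (1 - P(n,n)) with P(n,n) at most 2 S^n, so psi_n and mu define the same time
  scale. In the product for psi_n the numerators are explicit and the denominators converge to the
  q-Pochhammer constant.\<close>

section \<open>Renewal sequences with geometrically small errors\<close>

text \<open>This family is closed under partial sums, so each summation by parts turns one moment into the
  next, and it is submultiplicative, so it passes through convolutions.\<close>

definition rising_weight :: "nat \<Rightarrow> nat \<Rightarrow> real" where
  "rising_weight r t = real ((t + r) choose r)"

lemma rising_weight_0 [simp]: "rising_weight 0 t = 1"
  by (simp add: rising_weight_def)

lemma rising_weight_nonneg: "0 \<le> rising_weight r t"
  by (simp add: rising_weight_def)

lemma sum_rising_weight: "(\<Sum>s\<le>t. rising_weight r s) = rising_weight (Suc r) t"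
  using arg_cong[OF choose_rising_sum(1)[of r t], of real]
  by (simp add: rising_weight_def add.commute)

lemma rising_weight_Suc:
  "rising_weight (Suc r) t = rising_weight r t * (real (t + r + 1) / real (r + 1))"
proof -
  have "real (Suc r) * real (Suc (t + r) choose Suc r) = real (Suc (t + r)) * real (t + r choose r)"
    by (metis Suc_times_binomial of_nat_mult)
  then show ?thesis
    by (simp add: rising_weight_def field_simps)
qed

text \<open>Passing from order \<open>r\<close> to \<open>Suc r\<close> multiplies the weight at
  \<open>t\<close> by 1 + t / (r + 1), and 1 + x + y is at most (1 + x)(1 + y) for nonnegative x,
  y.\<close>

lemma rising_weight_submult:
  "rising_weight r (s + t) \<le> rising_weight r s * rising_weight r t"
proof (induction r)
  case (Suc r)
  have "real (s + t + r + 1) * real (r + 1) \<le> real (s + r + 1) * real (t + r + 1)"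
  proof -
    have "(s + t + r + 1) * (r + 1) \<le> (s + r + 1) * (t + r + 1)"
      by (simp add: algebra_simps)
    then show ?thesis
      by (simp only: of_nat_le_iff flip: of_nat_mult)
  qed
  then have "real (s + t + r + 1) / real (r + 1)
      \<le> (real (s + r + 1) / real (r + 1)) * (real (t + r + 1) / real (r + 1))"
    by (simp add: divide_simps)
  then have "rising_weight (Suc r) (s + t) \<le> (rising_weight r s * rising_weight r t) *
      ((real (s + r + 1) / real (r + 1)) * (real (t + r + 1) / real (r + 1)))"
    unfolding rising_weight_Suc
    by (intro mult_mono Suc) (auto intro!: mult_nonneg_nonneg rising_weight_nonneg)
  then show ?case
    unfolding rising_weight_Suc by (simp only: mult_ac)
qed simp

text \<open>\<open>R\<close> is the tail sum of \<open>g\<close>, so this is an exchange of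
  summation order. With \<open>w\<close> a rising weight, the partial sums of \<open>w\<close> are
  the weight of the next order. Only the series with \<open>R\<close> is assumed to converge; the
  other one is obtained.\<close>

lemma sums_by_parts_tail:
  fixes w g R :: "nat \<Rightarrow> real"
  assumes w: "\<And>t. 0 \<le> w t" and g: "\<And>t. 0 \<le> g t"
    and R: "\<And>t. R t - R (Suc t) = g t" and lim: "R \<longlonglongrightarrow> 0"
    and sm: "summable (\<lambda>t. w t * R t)"
  shows "(\<lambda>t. (\<Sum>s\<le>t. w s) * g t) sums (\<Sum>t. w t * R t)"
proof -
  define W where "W t = (\<Sum>s\<le>t. w s)" for t
  have W_nonneg: "0 \<le> W t" for t
    unfolding W_def by (intro sum_nonneg w)
  have dec: "decseq R"
  proof (rule decseq_SucI)
    show "R (Suc t) \<le> R t" for t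
      using R[of t] g[of t] by linarith
  qed
  have R_nonneg: "0 \<le> R t" for t
    by (rule decseq_ge[OF dec lim])
  have abel: "(\<Sum>t<N. w t * R t) = (\<Sum>t<N. W t * g t) + (\<Sum>t<N. w t) * R N" for N
  proof (induction N)
    case (Suc N)
    have WN: "W N = (\<Sum>t<N. w t) + w N"
      unfolding W_def by (simp flip: lessThan_Suc_atMost)
    have "R N = g N + R (Suc N)"
      using R[of N] by linarith
    then have "W N * R N = W N * g N + W N * R (Suc N)"
      by (simp only: distrib_left)
    moreover have "W N * R N = (\<Sum>t<N. w t) * R N + w N * R N"
      "W N * R (Suc N) = (\<Sum>t<Suc N. w t) * R (Suc N)"
      unfolding WN by (simp_all only: distrib_right sum.lessThan_Suc)
    ultimately show ?case
      using Suc unfolding sum.lessThan_Suc[of "\<lambda>t. w t * R t"] sum.lessThan_Suc[of "\<lambda>t. W t * g t"]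
      by linarith
  qed simp
  \<comment> \<open>The boundary term in \<open>abel\<close> is nonnegative, so dropping it already
    bounds the partial sums, before it is known to vanish.\<close>
  have sumg: "summable (\<lambda>t. W t * g t)"
  proof (rule summableI_nonneg_bounded)
    show "(\<Sum>t<N. W t * g t) \<le> (\<Sum>t. w t * R t)" for N
    proof -
      have "(\<Sum>t<N. W t * g t) \<le> (\<Sum>t<N. w t * R t)"
        unfolding abel by (simp add: w R_nonneg sum_nonneg)
      also have "\<dots> \<le> (\<Sum>t. w t * R t)"
        by (intro sum_le_suminf sm) (auto intro: mult_nonneg_nonneg w R_nonneg)
      finally show ?thesis .
    qed
  qed (intro mult_nonneg_nonneg W_nonneg g)
  have R_tail: "(\<lambda>t. g (t + N)) sums R N" for N
  proof -
    have "(\<Sum>t<M. g (t + N)) = R N - R (M + N)" for M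
    proof (induction M)
      case (Suc M)
      then show ?case
        using R[of "M + N"] by simp
    qed simp
    moreover have "(\<lambda>M. R N - R (M + N)) \<longlonglongrightarrow> R N - 0"
      by (rule tendsto_diff[OF tendsto_const LIMSEQ_ignore_initial_segment[OF lim]])
    ultimately show ?thesis
      by (simp add: sums_def)
  qed
  \<comment> \<open>The boundary term is at most a tail of the series just shown to converge,
    because \<open>W\<close> is nondecreasing; this forces it to 0.\<close>
  have upper: "(\<Sum>t<N. w t) * R N \<le> (\<Sum>t. W (t + N) * g (t + N))" for N
  proof -
    have "(\<Sum>t<N. w t) * R N = (\<Sum>t. (\<Sum>s<N. w s) * g (t + N))"
      using sums_mult[OF R_tail[of N]] by (simp add: sums_iff)
    also have "\<dots> \<le> (\<Sum>t. W (t + N) * g (t + N))"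
    proof (intro suminf_le allI mult_right_mono g)
      show "(\<Sum>s<N. w s) \<le> W (t + N)" for t
        unfolding W_def by (intro sum_mono2) (auto simp: w)
      show "summable (\<lambda>t. (\<Sum>s<N. w s) * g (t + N))"
        using sums_mult[OF R_tail[of N]] by (simp add: sums_iff)
      show "summable (\<lambda>t. W (t + N) * g (t + N))"
        using summable_ignore_initial_segment[OF sumg] .
    qed
    finally show ?thesis .
  qed
  have "(\<lambda>N. (\<Sum>t<N. w t) * R N) \<longlonglongrightarrow> 0"
  proof (rule Lim_null_comparison)
    show "(\<lambda>N. \<Sum>t. W (t + N) * g (t + N)) \<longlonglongrightarrow> 0"
      using suminf_exist_split2[OF sumg] .
    show "\<forall>\<^sub>F N in sequentially. norm ((\<Sum>t<N. w t) * R N) \<le> (\<Sum>t. W (t + N) * g (t + N))"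
    proof (intro always_eventually allI)
      fix N
      have "0 \<le> (\<Sum>t<N. w t) * R N"
        by (intro mult_nonneg_nonneg sum_nonneg w R_nonneg)
      then show "norm ((\<Sum>t<N. w t) * R N) \<le> (\<Sum>t. W (t + N) * g (t + N))"
        using upper[of N] unfolding real_norm_def by linarith
    qed
  qed
  then have "(\<lambda>N. (\<Sum>t<N. w t * R t) - (\<Sum>t<N. w t) * R N) \<longlonglongrightarrow> (\<Sum>t. w t * R t) - 0"
    by (rule tendsto_diff[OF summable_LIMSEQ[OF sm]])
  then show ?thesis
    unfolding sums_def abel W_def by simp
qed

text \<open>\<open>S ^ t\<close> is the tail sum of \<open>(1 - S) * S ^ t\<close>, so each
  summation by parts reproduces the geometric sequence and raises the weight by one order.\<close>

lemma summable_rising_weight_geometric: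
  fixes S :: real
  assumes "0 < S" "S < 1"
  shows "summable (\<lambda>t. rising_weight r t * S ^ t)"
proof (induction r)
  case (Suc r)
  have "(\<lambda>t. (\<Sum>s\<le>t. rising_weight r s) * ((1 - S) * S ^ t)) sums (\<Sum>t. rising_weight r t * S ^ t)"
    using assms Suc
    by (intro sums_by_parts_tail)
       (auto simp: rising_weight_nonneg algebra_simps intro!: LIMSEQ_power_zero)
  then have "summable (\<lambda>t. (1 - S) * (rising_weight (Suc r) t * S ^ t))"
    by (simp add: sum_rising_weight sums_iff mult_ac)
  then show ?case
    using assms by (subst (asm) summable_cmult_iff) auto
qed (use assms in \<open>simp add: summable_geometric\<close>)

text \<open>For a chain with a marked target state: \<open>f\<close> is the law of the first passage
  from the start, \<open>u\<close> and \<open>q\<close> are the probabilities of being in the target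
  when started from the target and from the start, and \<open>\<nu>\<close> is the stationary mass
  of the target. Closeness is required from time 1 on, since \<open>u\<close> is 1 and
  \<open>q\<close> is 0 at time 0.\<close>

locale renewal_sequence =
  fixes f u q :: "nat \<Rightarrow> real" and \<nu> \<eta> S :: real
  assumes f_nonneg: "0 \<le> f t" and f_0: "f 0 = 0" and f_mass: "(\<Sum>s\<le>t. f s) \<le> 1"
    and renewal: "q t = (\<Sum>s\<le>t. f s * u (t - s))" and u_0: "u 0 = 1"
    and u_close: "\<bar>u (Suc t) - \<nu>\<bar> \<le> \<eta> * S ^ Suc t"
    and q_close: "\<bar>q (Suc t) - \<nu>\<bar> \<le> \<eta> * S ^ Suc t"
    and nu_pos: "0 < \<nu>" and eta_nonneg: "0 \<le> \<eta>"
    and S_pos: "0 < S" and S_less: "S < 1"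
begin

definition h :: "nat \<Rightarrow> real" where "h t = 1 - (\<Sum>s\<le>t. f s)"

text \<open>The value at 0 is reset because u starts at 1, far from its limit: that term carries the main contribution to the convolution with h and is split off.\<close>

definition e :: "nat \<Rightarrow> real" where "e t = (if t = 0 then 0 else u t - \<nu>)"
definition d :: "nat \<Rightarrow> real" where "d t = (if t = 0 then 0 else q t - \<nu>)"

definition drift :: "nat \<Rightarrow> real" where "drift t = (\<Sum>s\<le>t. e s - d s)"
definition memory :: "nat \<Rightarrow> real" where "memory t = (\<Sum>s\<le>t. e s * h (t - s))"

section \<open>The tail identity and the comparison with a geometric tail\<close>

lemma h_0: "h 0 = 1"
  by (simp add: h_def f_0)

lemma h_nonneg: "0 \<le> h t"
  using f_mass[of t] by (simp add: h_def)

lemma h_Suc: "h t - h (Suc t) = f (Suc t)"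
  by (simp add: h_def)

lemma h_le_1: "h t \<le> 1"
  by (simp add: h_def sum_nonneg f_nonneg)

lemma e_le: "\<bar>e t\<bar> \<le> \<eta> * S ^ t"
  using u_close[of "t - 1"] eta_nonneg by (cases t) (auto simp: e_def)

lemma d_le: "\<bar>d t\<bar> \<le> \<eta> * S ^ t"
  using q_close[of "t - 1"] eta_nonneg by (cases t) (auto simp: d_def)

lemma geo_sums: "(\<lambda>t. S ^ t) sums (1 / (1 - S))"
  using S_pos S_less by (intro geometric_sums) auto

lemma geo_partial: "(\<Sum>s\<in>A. S ^ s) \<le> 1 / (1 - S)" if "finite A"
  using sum_le_suminf[of "\<lambda>t. S ^ t" A] geo_sums S_pos that by (auto simp: sums_iff)

text \<open>In generating functions, H = (1 - F) / (1 - z) and Q = F U, hence H U = (U - Q) / (1 -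
  z). The induction on \<open>t\<close> is this computation coefficient by coefficient.\<close>

lemma tail_conv_u: "(\<Sum>s\<le>t. h (t - s) * u s) = (\<Sum>s\<le>t. u s - q s)"
proof (induction t)
  case 0
  show ?case using renewal[of 0] by (simp add: h_0 f_0)
next
  case (Suc t)
  have q: "q (Suc t) = (\<Sum>s\<le>t. f (Suc t - s) * u s)"
  proof -
    have "q (Suc t) = (\<Sum>s\<le>Suc t. f (Suc t - s) * u s)"
      unfolding renewal
      by (rule sum.reindex_bij_witness[of _ "\<lambda>s. Suc t - s" "\<lambda>s. Suc t - s"]) auto
    then show ?thesis by (simp add: f_0)
  qed
  have "(\<Sum>s\<le>Suc t. h (Suc t - s) * u s) - (\<Sum>s\<le>t. h (t - s) * u s)
      = u (Suc t) + (\<Sum>s\<le>t. (h (Suc t - s) - h (t - s)) * u s)"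
    by (simp add: h_0 sum_subtractf left_diff_distrib)
  also have "(\<Sum>s\<le>t. (h (Suc t - s) - h (t - s)) * u s) = (\<Sum>s\<le>t. - (f (Suc t - s) * u s))"
    by (intro sum.cong) (auto simp: Suc_diff_le simp flip: h_Suc, auto simp: algebra_simps)
  finally show ?case
    using Suc q by (simp add: sum_negf)
qed

lemma tail_identity: "h t + \<nu> * (\<Sum>s<t. h s) = 1 + drift t - memory t"
proof -
  \<comment> \<open>At \<open>s = 0\<close> the split \<open>u = \<nu> + e\<close> misses
    \<open>1 - \<nu>\<close>. That correction later merges with the last term
    \<open>\<nu> * h t\<close> of the sum into a full \<open>h t\<close>, which is why the sum in
    the identity stops before \<open>t\<close>.\<close>
  have "(\<Sum>s\<le>t. h (t - s) * u s)
      = (\<Sum>s\<le>t. \<nu> * h (t - s) + e s * h (t - s) + (if s = 0 then (1 - \<nu>) * h t else 0))"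
    by (intro sum.cong) (auto simp: e_def u_0 algebra_simps)
  also have "\<dots> = \<nu> * (\<Sum>s\<le>t. h (t - s)) + memory t + (1 - \<nu>) * h t"
    by (simp add: sum.distrib sum_distrib_left memory_def)
  also have "(\<Sum>s\<le>t. h (t - s)) = (\<Sum>s\<le>t. h s)"
    by (rule sum.reindex_bij_witness[of _ "\<lambda>s. t - s" "\<lambda>s. t - s"]) auto
  also have "\<dots> = (\<Sum>s<t. h s) + h t"
    by (simp flip: lessThan_Suc_atMost)
  finally have 1: "(\<Sum>s\<le>t. h (t - s) * u s) = \<nu> * (\<Sum>s<t. h s) + h t + memory t"
    by (simp add: algebra_simps)
  \<comment> \<open>The limit \<open>\<nu>\<close> cancels in \<open>u - q\<close> at positive
    times; time 0 contributes \<open>u 0 - q 0 = 1\<close>, the constant of the identity.\<close>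
  have "(\<Sum>s\<le>t. u s - q s) = (\<Sum>s\<le>t. (e s - d s) + (if s = 0 then 1 else 0))"
    using renewal[of 0] by (intro sum.cong) (auto simp: e_def d_def u_0 f_0)
  then show ?thesis
    using 1 tail_conv_u[of t] by (simp add: sum.distrib drift_def)
qed

lemma drift_le: "\<bar>drift t\<bar> \<le> 2 * \<eta> / (1 - S)"
proof -
  have "\<bar>drift t\<bar> \<le> (\<Sum>s\<le>t. 2 * \<eta> * S ^ s)"
    unfolding drift_def
  proof (rule order_trans[OF sum_abs], rule sum_mono)
    show "\<bar>e s - d s\<bar> \<le> 2 * \<eta> * S ^ s" for s
      using e_le[of s] d_le[of s] by linarith
  qed
  also have "\<dots> \<le> 2 * \<eta> * (1 / (1 - S))"
    unfolding sum_distrib_left[symmetric] using eta_nonneg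
    by (intro mult_left_mono geo_partial) auto
  finally show ?thesis by simp
qed

text \<open>A majorant for \<open>memory\<close> that keeps the decay of \<open>h\<close> in
  \<open>t\<close>. The uniform bound \<open>memory_le\<close> serves the limit law, but summing
  over \<open>t\<close> for the moments needs this form.\<close>

definition smooth :: "nat \<Rightarrow> real" where "smooth t = (\<Sum>s\<le>t. S ^ s * h (t - s))"

lemma memory_le_smooth: "\<bar>memory t\<bar> \<le> \<eta> * smooth t"
  unfolding memory_def smooth_def sum_distrib_left
proof (rule order_trans[OF sum_abs], rule sum_mono)
  show "\<bar>e s * h (t - s)\<bar> \<le> \<eta> * (S ^ s * h (t - s))" for s
    using mult_right_mono[OF e_le[of s] h_nonneg[of "t - s"]] h_nonneg[of "t - s"]
    by (simp add: abs_mult mult_ac)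
qed

lemma memory_le: "\<bar>memory t\<bar> \<le> \<eta> / (1 - S)"
proof -
  have "smooth t \<le> (\<Sum>s\<le>t. S ^ s)"
    unfolding smooth_def using S_pos h_le_1
    by (intro sum_mono) (simp add: mult_left_le)
  also have "\<dots> \<le> 1 / (1 - S)"
    by (rule geo_partial) auto
  finally have "\<eta> * smooth t \<le> \<eta> * (1 / (1 - S))"
    by (intro mult_left_mono eta_nonneg)
  with memory_le_smooth[of t] show ?thesis by simp
qed

text \<open>\<open>(1 - \<nu>) ^ t\<close> solves the tail identity exactly when the errors are
  dropped. The 3 adds the 2 of \<open>drift_le\<close> and the 1 of \<open>memory_le\<close>, and
  \<open>(1 + \<nu>) ^ t\<close> solves the recursion y_t = 1 + \<open>\<nu>\<close> (y_0 + ... +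
  y_(t-1)) of the accumulated error. At times of order \<open>1 / \<nu>\<close> this growth factor
  stays bounded.\<close>

lemma tail_geometric: "\<bar>h t - (1 - \<nu>) ^ t\<bar> \<le> 3 * \<eta> / (1 - S) * (1 + \<nu>) ^ t"
proof (induction t rule: less_induct)
  case (less t)
  define \<epsilon> where "\<epsilon> = 3 * \<eta> / (1 - S)"
  have geo: "(1 - \<nu>) ^ t + \<nu> * (\<Sum>s<t. (1 - \<nu>) ^ s) = 1" for t
    by (induction t) (auto simp: algebra_simps)
  have geo': "1 + \<nu> * (\<Sum>s<t. (1 + \<nu>) ^ s) = (1 + \<nu>) ^ t" for t
    by (induction t) (auto simp: algebra_simps)
  have "h t - (1 - \<nu>) ^ t = drift t - memory t - \<nu> * (\<Sum>s<t. h s - (1 - \<nu>) ^ s)"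
    using tail_identity[of t] geo[of t] by (simp add: sum_subtractf algebra_simps)
  moreover have "\<bar>drift t - memory t\<bar> \<le> \<epsilon>"
    using drift_le[of t] memory_le[of t] by (simp add: \<epsilon>_def add_divide_distrib[symmetric])
  moreover have "\<bar>\<nu> * (\<Sum>s<t. h s - (1 - \<nu>) ^ s)\<bar> \<le> \<nu> * (\<Sum>s<t. \<epsilon> * (1 + \<nu>) ^ s)"
    unfolding abs_mult using nu_pos less.IH
    by (auto intro!: mult_mono order_trans[OF sum_abs] sum_mono sum_nonneg simp: \<epsilon>_def)
  ultimately have "\<bar>h t - (1 - \<nu>) ^ t\<bar> \<le> \<epsilon> + \<nu> * (\<Sum>s<t. \<epsilon> * (1 + \<nu>) ^ s)"
    by linarith
  also have "\<dots> = \<epsilon> * (1 + \<nu>) ^ t"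
    unfolding geo'[of t, symmetric] by (simp add: sum_distrib_left algebra_simps)
  finally show ?case by (simp add: \<epsilon>_def)
qed

text \<open>As \<open>h\<close> is nonnegative, the tail identity bounds \<open>\<nu>\<close> times
  its partial sums. In particular the target is hit almost surely, whereas the locale only asks that
  \<open>f\<close> have mass at most 1.\<close>

lemma summable_h: "summable h"
proof (rule summableI_nonneg_bounded[OF h_nonneg])
  fix t
  have "\<nu> * (\<Sum>s<t. h s) \<le> 1 + 2 * \<eta> / (1 - S) + \<eta> / (1 - S)"
    using tail_identity[of t] drift_le[of t] memory_le[of t] h_nonneg[of t] by linarith
  then show "(\<Sum>s<t. h s) \<le> (1 + 2 * \<eta> / (1 - S) + \<eta> / (1 - S)) / \<nu>"
    using nu_pos by (simp add: pos_le_divide_eq mult.commute)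
qed

lemma h_tendsto_0: "h \<longlonglongrightarrow> 0"
  using summable_h by (rule summable_LIMSEQ_zero)

section \<open>Summing the tail identity: moments of every order\<close>

definition R :: "nat \<Rightarrow> real" where "R t = (\<Sum>s. h (s + t))"

lemma R_split: "suminf h = R t + (\<Sum>s<t. h s)"
  unfolding R_def by (rule suminf_split_initial_segment[OF summable_h])

lemma R_Suc: "R t - R (Suc t) = h t"
  using R_split[of t] R_split[of "Suc t"] by simp

lemma R_tendsto_0: "R \<longlonglongrightarrow> 0"
  unfolding R_def by (rule suminf_exist_split2[OF summable_h])

text \<open>Submultiplicativity splits the weight at \<open>t\<close> over \<open>s\<close> and
  \<open>t - s\<close>, so the weighted convolution is dominated by the Cauchy product of the two
  weighted series. The geometric factor depends on \<open>r\<close> and \<open>S\<close> alone,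
  which makes the moment estimates uniform in the chain.\<close>

lemma weighted_smooth:
  assumes "summable (\<lambda>t. rising_weight r t * h t)"
  shows "summable (\<lambda>t. rising_weight r t * smooth t)"
    and "(\<Sum>t. rising_weight r t * smooth t)
      \<le> (\<Sum>t. rising_weight r t * S ^ t) * (\<Sum>t. rising_weight r t * h t)"
proof -
  define a b where "a t = rising_weight r t * S ^ t" and "b t = rising_weight r t * h t" for t
  have nonneg: "0 \<le> a t" "0 \<le> b t" for t
    using S_pos by (auto simp: a_def b_def rising_weight_nonneg h_nonneg)
  have sm: "summable a" "summable b"
    unfolding a_def b_def using assms summable_rising_weight_geometric[OF S_pos S_less] by auto
  have prod: "(\<lambda>t. \<Sum>s\<le>t. a s * b (t - s)) sums (suminf a * suminf b)"
    using sm nonneg by (intro Cauchy_product_sums) simp_all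
  have le: "rising_weight r t * smooth t \<le> (\<Sum>s\<le>t. a s * b (t - s))" for t
    unfolding smooth_def sum_distrib_left
  proof (rule sum_mono)
    fix s assume "s \<in> {..t}"
    then have "rising_weight r t \<le> rising_weight r s * rising_weight r (t - s)"
      using rising_weight_submult[of r s "t - s"] by simp
    then have "rising_weight r t * (S ^ s * h (t - s))
        \<le> (rising_weight r s * rising_weight r (t - s)) * (S ^ s * h (t - s))"
      using S_pos by (intro mult_right_mono) (auto simp: h_nonneg)
    then show "rising_weight r t * (S ^ s * h (t - s)) \<le> a s * b (t - s)"
      by (simp add: a_def b_def mult_ac)
  qed
  have smooth_nonneg: "0 \<le> smooth t" for t
    unfolding smooth_def using S_pos by (intro sum_nonneg) (auto simp: h_nonneg)
  show *: "summable (\<lambda>t. rising_weight r t * smooth t)"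
    using le
    by (intro summable_comparison_test_ev[OF _ sums_summable[OF prod]] always_eventually allI)
       (simp add: rising_weight_nonneg smooth_nonneg)
  show "(\<Sum>t. rising_weight r t * smooth t)
      \<le> (\<Sum>t. rising_weight r t * S ^ t) * (\<Sum>t. rising_weight r t * h t)"
    using suminf_le[OF le * sums_summable[OF prod]] sums_unique[OF prod]
    unfolding a_def b_def by linarith
qed

lemma drift_tendsto: "drift \<longlonglongrightarrow> (\<Sum>s. e s - d s)"
  and drift_tail: "\<bar>(\<Sum>s. e s - d s) - drift t\<bar> \<le> 2 * \<eta> / (1 - S) * S ^ t"
proof -
  have bound: "norm (e s - d s) \<le> 2 * \<eta> * S ^ s" for s
    using e_le[of s] d_le[of s] unfolding real_norm_def by linarith
  have geo: "(\<lambda>s. 2 * \<eta> * S ^ s) sums (2 * \<eta> * (1 / (1 - S)))"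
    by (rule sums_mult[OF geo_sums])
  have sm: "summable (\<lambda>s. e s - d s)"
    by (rule summable_comparison_test'[OF sums_summable[OF geo] bound])
  show "drift \<longlonglongrightarrow> (\<Sum>s. e s - d s)"
    unfolding drift_def by (rule summable_LIMSEQ'[OF sm])
  have shift: "(\<lambda>s. 2 * \<eta> * S ^ Suc t * S ^ s) sums (2 * \<eta> * S ^ Suc t * (1 / (1 - S)))"
    by (rule sums_mult[OF geo_sums])
  have tail: "(\<Sum>s. e s - d s) - drift t = (\<Sum>s. e (s + Suc t) - d (s + Suc t))"
    using suminf_split_initial_segment[OF sm, of "Suc t"]
    unfolding drift_def lessThan_Suc_atMost by linarith
  have "norm (\<Sum>s. e (s + Suc t) - d (s + Suc t)) \<le> (\<Sum>s. 2 * \<eta> * S ^ Suc t * S ^ s)"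
  proof (rule norm_suminf_le[OF _ sums_summable[OF shift]])
    show "norm (e (s + Suc t) - d (s + Suc t)) \<le> 2 * \<eta> * S ^ Suc t * S ^ s" for s
      using bound[of "s + Suc t"] by (simp only: power_add ac_simps)
  qed
  also have "\<dots> = 2 * \<eta> / (1 - S) * S ^ t * S"
    unfolding sums_unique[OF shift, symmetric] by simp
  also have "\<dots> \<le> 2 * \<eta> / (1 - S) * S ^ t"
    using S_pos S_less eta_nonneg by (intro mult_left_le) auto
  finally show "\<bar>(\<Sum>s. e s - d s) - drift t\<bar> \<le> 2 * \<eta> / (1 - S) * S ^ t"
    unfolding tail real_norm_def .
qed

text \<open>Letting the time tend to infinity in \<open>tail_identity\<close> gives the value of
  \<open>\<nu> * suminf h\<close>; subtracting the identity at \<open>t\<close> leaves the tail sum.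
  The term \<open>memory\<close> vanishes in the limit because \<open>smooth\<close> is summable,
  the case of order 0 in \<open>weighted_smooth\<close>.\<close>

lemma tail_sum_identity: "\<nu> * R t = h t + ((\<Sum>s. e s - d s) - drift t) + memory t"
proof -
  have "summable smooth"
    using weighted_smooth(1)[of 0] summable_h by simp
  then have "(\<lambda>t. \<eta> * smooth t) \<longlonglongrightarrow> \<eta> * 0"
    by (intro tendsto_intros summable_LIMSEQ_zero)
  then have "memory \<longlonglongrightarrow> 0"
    using memory_le_smooth by (intro Lim_null_comparison[of memory]) auto
  then have "(\<lambda>t. 1 + drift t - memory t - h t) \<longlonglongrightarrow> 1 + (\<Sum>s. e s - d s) - 0 - 0"
    by (intro tendsto_intros drift_tendsto h_tendsto_0)
  moreover have "1 + drift t - memory t - h t = \<nu> * (\<Sum>s<t. h s)" for t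
    using tail_identity[of t] by linarith
  moreover have "(\<lambda>t. \<nu> * (\<Sum>s<t. h s)) \<longlonglongrightarrow> \<nu> * suminf h"
    by (intro tendsto_intros summable_LIMSEQ summable_h)
  ultimately have "\<nu> * suminf h = 1 + (\<Sum>s. e s - d s)"
    using LIMSEQ_unique by auto
  then show ?thesis
    using R_split[of t] tail_identity[of t] by (simp add: algebra_simps)
qed

text \<open>The 1 pays for \<open>memory\<close>, the \<open>2 / (1 - S)\<close> for the remaining
  part of \<open>drift\<close>.\<close>

definition const :: real where "const = 1 + 2 / (1 - S)"

lemma tail_sum_close: "\<bar>\<nu> * R t - h t\<bar> \<le> \<eta> * const * smooth t"
proof -
  \<comment> \<open>The summand \<open>s = t\<close> of \<open>smooth t\<close> is
    \<open>S ^ t\<close>, since \<open>h 0 = 1\<close>; this lets the geometric error of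
    \<open>drift\<close> be absorbed by \<open>smooth\<close> as well.\<close>
  have "S ^ t * h (t - t) \<le> smooth t"
    unfolding smooth_def using S_pos h_nonneg by (intro member_le_sum) auto
  then have "2 * \<eta> / (1 - S) * S ^ t \<le> 2 * \<eta> / (1 - S) * smooth t"
    using eta_nonneg S_less by (intro mult_left_mono) (auto simp: h_0)
  then show ?thesis
    using tail_sum_identity[of t] drift_tail[of t] memory_le_smooth[of t]
    by (simp add: const_def algebra_simps)
qed

text \<open>By \<open>rising_moment_sums\<close> this is the expectation of C(T + r, r + 1) for the
  first-passage time T: a moment of order r + 1, with \<open>B 0\<close> the mean.\<close>

definition B :: "nat \<Rightarrow> real" where "B r = (\<Sum>t. rising_weight r t * h t)"

text \<open>Summation by parts turns the weight of order \<open>Suc r\<close> against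
  \<open>h\<close> into the weight of order \<open>r\<close> against \<open>R\<close>, and
  \<open>\<nu> * R\<close> is \<open>h\<close> up to a multiple of \<open>smooth\<close>. The
  resulting error is relative to \<open>B r\<close>, so it survives iteration.\<close>

lemma moment_step:
  assumes "summable (\<lambda>t. rising_weight r t * h t)"
  shows "summable (\<lambda>t. rising_weight (Suc r) t * h t)"
    and "\<bar>\<nu> * B (Suc r) - B r\<bar> \<le> \<eta> * const * (\<Sum>t. rising_weight r t * S ^ t) * B r"
proof -
  define x where "x t = \<nu> * R t - h t" for t
  note smo = weighted_smooth[OF assms]
  have c: "0 \<le> const" using S_less by (simp add: const_def)
  have x_le: "norm (rising_weight r t * x t) \<le> \<eta> * const * (rising_weight r t * smooth t)" for t
    using mult_left_mono[OF tail_sum_close[of t] rising_weight_nonneg[of r t]]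
    by (simp add: x_def abs_mult rising_weight_nonneg mult_ac)
  have bound: "summable (\<lambda>t. \<eta> * const * (rising_weight r t * smooth t))"
    by (rule summable_mult[OF smo(1)])
  have sx: "summable (\<lambda>t. rising_weight r t * x t)"
    by (rule summable_comparison_test'[OF bound x_le])
  have Rx: "rising_weight r t * R t = (rising_weight r t * x t + rising_weight r t * h t) / \<nu>" for t
    using nu_pos by (simp add: x_def field_simps)
  have wR: "(\<lambda>t. rising_weight r t * R t) sums (((\<Sum>t. rising_weight r t * x t) + B r) / \<nu>)"
    unfolding Rx B_def by (rule sums_divide[OF sums_add[OF summable_sums[OF sx] summable_sums[OF assms]]])
  have *: "(\<lambda>t. rising_weight (Suc r) t * h t) sums (((\<Sum>t. rising_weight r t * x t) + B r) / \<nu>)"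
    using sums_by_parts_tail[OF rising_weight_nonneg h_nonneg R_Suc R_tendsto_0 sums_summable[OF wR]]
    unfolding sum_rising_weight sums_unique[OF wR, symmetric] .
  then show "summable (\<lambda>t. rising_weight (Suc r) t * h t)"
    by (rule sums_summable)
  have "\<nu> * B (Suc r) - B r = (\<Sum>t. rising_weight r t * x t)"
    using sums_unique[OF *] nu_pos by (simp add: B_def field_simps)
  then have "\<bar>\<nu> * B (Suc r) - B r\<bar> \<le> (\<Sum>t. \<eta> * const * (rising_weight r t * smooth t))"
    using norm_suminf_le[OF x_le bound] by simp
  also have "\<dots> = \<eta> * const * (\<Sum>t. rising_weight r t * smooth t)"
    by (rule suminf_mult[OF smo(1)])
  also have "\<dots> \<le> \<eta> * const * ((\<Sum>t. rising_weight r t * S ^ t) * B r)"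
    using smo(2) c eta_nonneg by (intro mult_left_mono) (auto simp: B_def)
  finally show "\<bar>\<nu> * B (Suc r) - B r\<bar> \<le> \<eta> * const * (\<Sum>t. rising_weight r t * S ^ t) * B r"
    by (simp add: mult_ac)
qed

lemma summable_weight_h: "summable (\<lambda>t. rising_weight r t * h t)"
  by (induction r) (auto intro: moment_step summable_h)

lemma B_0_close: "\<bar>\<nu> * B 0 - 1\<bar> \<le> \<eta> * const"
proof -
  have "B 0 = R 0" by (simp add: B_def R_def)
  then show ?thesis
    using tail_sum_close[of 0] by (simp add: smooth_def h_0)
qed

lemma rising_moment_sums: "(\<lambda>t. rising_weight (Suc r) t * f (Suc t)) sums B r"
  using sums_by_parts_tail[of "rising_weight r" "\<lambda>t. f (Suc t)" h]
  by (simp add: rising_weight_nonneg f_nonneg h_Suc h_tendsto_0 summable_weight_h sum_rising_weight B_def)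

end

section \<open>The count chain\<close>

text \<open>Each set of \<open>m\<close> trials succeeds entirely with probability
  \<open>p ^ m\<close>. The induction conditions on one trial and applies Pascal's rule.\<close>

lemma expectation_binomial_pmf_choose:
  assumes "p \<in> {0..1}"
  shows "measure_pmf.expectation (binomial_pmf n p) (\<lambda>k. real (k choose m)) = real (n choose m) * p ^ m"
proof (induction n arbitrary: m)
  case 0
  show ?case
    using assms by (cases m) (auto simp: binomial_pmf_0)
next
  case (Suc n)
  show ?case
  proof (cases m)
    case [simp]: (Suc l)
    note int = integrable_binomial_pmf[OF assms]
    have "measure_pmf.expectation (binomial_pmf (Suc n) p) (\<lambda>k. real (k choose m)) =
        p * measure_pmf.expectation (binomial_pmf n p) (\<lambda>k. real (k choose l) + real (k choose m))
        + (1 - p) * measure_pmf.expectation (binomial_pmf n p) (\<lambda>k. real (k choose m))"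
    proof -
      have "binomial_pmf (Suc n) p
          = bernoulli_pmf p \<bind> (\<lambda>b. map_pmf (\<lambda>k. (if b then 1 else 0) + k) (binomial_pmf n p))"
        using assms by (simp add: binomial_pmf_Suc map_pmf_def)
      then show ?thesis
        using assms finite_set_pmf_binomial_pmf[OF assms, of n]
        by (simp only:, subst pmf_expectation_bind[where A = "{False, True}"]) auto
    qed
    also have "\<dots> = p * (real (n choose l) * p ^ l + real (n choose m) * p ^ m)
        + (1 - p) * (real (n choose m) * p ^ m)"
      using Suc.IH by (subst Bochner_Integration.integral_add[OF int int]) simp
    also have "\<dots> = real (Suc n choose m) * p ^ m"
      by (simp add: algebra_simps)
    finally show ?thesis .
  qed simp
qed

lemma expectation_add_bernoulli:
  fixes g :: "nat \<Rightarrow> real"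
  assumes "finite (set_pmf X)" "0 \<le> p" "p \<le> 1"
  shows "measure_pmf.expectation
      (map_pmf (\<lambda>(x, y). x + (if y then 1 else 0)) (pair_pmf X (bernoulli_pmf p))) g
    = measure_pmf.expectation X (\<lambda>x. p * g (Suc x) + (1 - p) * g x)"
proof -
  have "map_pmf (\<lambda>(x, y). x + (if y then 1 else 0)) (pair_pmf X (bernoulli_pmf p))
      = bind_pmf X (\<lambda>x. map_pmf (\<lambda>y. x + (if y then 1 else 0)) (bernoulli_pmf p))"
    by (simp add: pair_pmf_def map_pmf_def bind_assoc_pmf bind_return_pmf)
  also have "measure_pmf.expectation \<dots> g = (\<Sum>x\<in>set_pmf X. pmf X x *\<^sub>R
      measure_pmf.expectation (map_pmf (\<lambda>y. x + (if y then 1 else 0)) (bernoulli_pmf p)) g)"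
    using assms by (intro pmf_expectation_bind) auto
  also have "\<dots> = (\<Sum>x\<in>set_pmf X. pmf X x *\<^sub>R (p * g (Suc x) + (1 - p) * g x))"
    using assms by (simp add: mult.commute)
  also have "\<dots> = measure_pmf.expectation X (\<lambda>x. p * g (Suc x) + (1 - p) * g x)"
    using assms by (subst integral_measure_pmf[of "set_pmf X"]) auto
  finally show ?thesis .
qed

locale cc_chain =
  fixes Q S :: real and n :: nat
  assumes Q_pos: "0 < Q" and Q_le: "Q \<le> 1" and S_pos: "0 < S" and S_less: "S < 1" and n_pos: "0 < n"
begin

abbreviation P :: "nat \<Rightarrow> nat \<Rightarrow> real" where "P k j \<equiv> pmf (cc_kernel Q S n k) j"

text \<open>\<open>phi m k\<close> is the probability that a uniformly random set of
  \<open>m\<close> types lies inside a fixed set of \<open>k\<close> present types. After one round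
  such a set is present if all its members survive thinning and either the selection missed it
  (factor \<open>a m\<close>, the set was present before), or the selection hit it and refreshed to
  present (factor \<open>c m\<close>, the other m - 1 types were present before).\<close>

definition phi :: "nat \<Rightarrow> nat \<Rightarrow> real" where "phi m k = real (k choose m) / real (n choose m)"
definition a :: "nat \<Rightarrow> real" where "a m = S ^ m * (1 - real m / real n)"
definition c :: "nat \<Rightarrow> real" where "c m = S ^ m * Q * (real m / real n)"
definition psi :: "nat \<Rightarrow> real" where "psi m = (\<Prod>i=1..m. c i / (1 - a i))"
definition Pop :: "(nat \<Rightarrow> real) \<Rightarrow> nat \<Rightarrow> real" where "Pop g k = (\<Sum>j\<le>n. P k j * g j)"

lemma QS: "0 \<le> Q * S" "Q * S \<le> 1"
  using Q_pos Q_le S_pos S_less by (auto intro: mult_le_one)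

lemma set_kernel: "set_pmf (cc_kernel Q S n k) \<subseteq> {..n}" if "k \<le> n"
proof -
  have "x + (if y then 1 else 0) \<le> n"
    if b: "b \<in> set_pmf (bernoulli_pmf (real k / real n))" and x: "x \<le> (if b then k - 1 else k)"
    for b x y
  \<comment> \<open>At \<open>k = n\<close> the selected type is present almost surely, so only n -
    1 further coupons are thinned and the refreshed one cannot raise the count above
    \<open>n\<close>.\<close>
  proof (cases "k = n")
    case True
    then have "b"
      using b n_pos by (cases b) (auto simp: set_pmf_iff)
    then show ?thesis using x n_pos True by auto
  next
    case False
    then show ?thesis using x \<open>k \<le> n\<close> by (auto split: if_splits)
  qed
  then show ?thesis
    using S_pos S_less by (auto simp: cc_kernel_def)
qed

lemma Pop_eq_expectation: "Pop g k = measure_pmf.expectation (cc_kernel Q S n k) g" if "k \<le> n"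
  unfolding Pop_def using set_kernel[OF that]
  by (subst integral_measure_pmf[of "{..n}"]) auto

lemma expectation_kernel_choose:
  assumes "k \<le> n"
  shows "measure_pmf.expectation (cc_kernel Q S n k) (\<lambda>i. real (i choose Suc m))
    = S ^ Suc m * ((1 - real (Suc m) / real n) * real (k choose Suc m)
        + Q * ((1 - real m / real n) * real (k choose m)))"
proof -
  define x where "x = real k / real n"
  have x: "0 \<le> x" "x \<le> 1"
    using assms n_pos by (auto simp: x_def)
  have S01: "S \<in> {0..1}" using S_pos S_less by auto
  note int = integrable_binomial_pmf[OF S01]
  have half: "measure_pmf.expectation (map_pmf (\<lambda>(x, y). x + (if y then 1 else 0))
        (pair_pmf (binomial_pmf l S) (bernoulli_pmf (Q * S)))) (\<lambda>i. real (i choose Suc m))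
      = S ^ Suc m * (real (l choose Suc m) + Q * real (l choose m))" for l
  proof -
    have "measure_pmf.expectation (map_pmf (\<lambda>(x, y). x + (if y then 1 else 0))
        (pair_pmf (binomial_pmf l S) (bernoulli_pmf (Q * S)))) (\<lambda>i. real (i choose Suc m))
      = measure_pmf.expectation (binomial_pmf l S)
          (\<lambda>i. Q * S * real (i choose m) + real (i choose Suc m))"
      using QS finite_set_pmf_binomial_pmf[OF S01]
      by (subst expectation_add_bernoulli) (auto simp: algebra_simps)
    also have "\<dots> = Q * S * (real (l choose m) * S ^ m) + real (l choose Suc m) * S ^ Suc m"
      by (subst Bochner_Integration.integral_add[OF int int])
         (simp add: expectation_binomial_pmf_choose[OF S01])
    finally show ?thesis by (simp add: algebra_simps)
  qed
  have "measure_pmf.expectation (cc_kernel Q S n k) (\<lambda>i. real (i choose Suc m))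
    = x * (S ^ Suc m * (real (k - 1 choose Suc m) + Q * real (k - 1 choose m)))
      + (1 - x) * (S ^ Suc m * (real (k choose Suc m) + Q * real (k choose m)))"
    unfolding cc_kernel_def
    using x finite_set_pmf_binomial_pmf[OF S01]
    by (subst pmf_expectation_bind[where A = "{False, True}"])
       (auto simp: half[simplified integral_map_pmf] simp del: power_Suc simp flip: x_def)
  also have "\<dots> = S ^ Suc m * ((real (k choose Suc m) - x * (real (k choose Suc m) - real (k - 1 choose Suc m)))
      + Q * (real (k choose m) - x * (real (k choose m) - real (k - 1 choose m))))"
    by (simp add: algebra_simps)
  finally have *: "measure_pmf.expectation (cc_kernel Q S n k) (\<lambda>i. real (i choose Suc m))
    = S ^ Suc m * ((real (k choose Suc m) - x * (real (k choose Suc m) - real (k - 1 choose Suc m)))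
      + Q * (real (k choose m) - x * (real (k choose m) - real (k - 1 choose m))))" .
  \<comment> \<open>Absorption, l C(k,l) = k C(k-1,l-1), trades the state-dependent selection
    probability k / n for the constant l / n. This is why the factorial moments close under the
    kernel.\<close>
  have "x * (real (k choose l) - real (k - 1 choose l)) = real l / real n * real (k choose l)" for l
  proof (cases k; cases l)
    fix k' l' assume [simp]: "k = Suc k'" "l = Suc l'"
    have "real (Suc l') * real (Suc k' choose Suc l') = real (Suc k') * real (k' choose l')"
      by (metis Suc_times_binomial of_nat_mult)
    then show ?thesis
      using n_pos by (simp add: x_def field_simps)
  qed (auto simp: x_def)
  then show ?thesis
    unfolding * by (simp add: left_diff_distrib del: of_nat_Suc)
qed

section \<open>Relaxation of the normalised factorial moments\<close>

lemma choose_pos: "0 < real (n choose m)" if "m \<le> n"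
  using that by simp

lemma Pop_phi_0: "Pop (phi 0) k = 1" if "k \<le> n"
proof -
  have "phi 0 = (\<lambda>_. 1)" by (simp add: phi_def fun_eq_iff)
  then show ?thesis using that by (simp add: Pop_eq_expectation)
qed

lemma Pop_phi_Suc:
  assumes "k \<le> n" "Suc m \<le> n"
  shows "Pop (phi (Suc m)) k = a (Suc m) * phi (Suc m) k + c (Suc m) * phi m k"
proof -
  \<comment> \<open>Changing the normaliser from C(n,m+1) to C(n,m) converts the factor 1 - m / n of
    the raw moment into the (m + 1) / n of \<open>c (Suc m)\<close>.\<close>
  have "real (Suc m) * real (n choose Suc m) = real (n - m) * real (n choose m)"
    by (metis binomial_absorb_comp binomial_absorption mult.commute of_nat_mult)
  then have "(real n - real m) / real (n choose Suc m) = real (Suc m) / real (n choose m)"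
    using assms by (simp add: frac_eq_eq mult.commute)
  moreover have "1 - real m / real n = (real n - real m) / real n"
    using n_pos by (simp add: diff_divide_distrib)
  ultimately have ratio: "(1 - real m / real n) / real (n choose Suc m) = (real (Suc m) / real n) / real (n choose m)"
    by (metis divide_divide_eq_left mult.commute)
  have "phi (Suc m) = (\<lambda>i. real (i choose Suc m) / real (n choose Suc m))"
    by (simp add: phi_def fun_eq_iff)
  then have "Pop (phi (Suc m)) k = measure_pmf.expectation (cc_kernel Q S n k) (\<lambda>i. real (i choose Suc m))
      / real (n choose Suc m)"
    using assms by (simp add: Pop_eq_expectation)
  also have "\<dots> = a (Suc m) * phi (Suc m) k
      + S ^ Suc m * Q * real (k choose m) * ((1 - real m / real n) / real (n choose Suc m))"
    unfolding expectation_kernel_choose[OF assms(1)] a_def phi_def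
    by (simp add: add_divide_distrib distrib_left mult.assoc del: of_nat_Suc)
  also have "\<dots> = a (Suc m) * phi (Suc m) k + c (Suc m) * phi m k"
    unfolding ratio c_def phi_def by simp
  finally show ?thesis .
qed

lemma phi_n: "phi n k = (if k = n then 1 else 0)" if "k \<le> n"
  using that by (auto simp: phi_def)

lemma phi_bounds: "0 \<le> phi m k" "phi m k \<le> 1" if "k \<le> n" "m \<le> n"
  using that choose_pos[of m] binomial_right_mono[of k n m] by (auto simp: phi_def)

lemma a_nonneg: "0 \<le> a m" if "m \<le> n"
  using that S_pos n_pos by (auto simp: a_def)

lemma c_nonneg: "0 \<le> c m"
  using S_pos Q_pos by (simp add: c_def)

lemma a_n [simp]: "a n = 0"
  using n_pos by (simp add: a_def)

lemma a_plus_c: "a m + c m \<le> S ^ m"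
proof -
  have "Q * (real m / real n) \<le> real m / real n"
    using Q_pos Q_le by (intro mult_left_le_one_le) auto
  then have "S ^ m * (1 - real m / real n + Q * (real m / real n)) \<le> S ^ m * 1"
    using S_pos by (intro mult_left_mono) auto
  then show ?thesis by (simp add: a_def c_def algebra_simps)
qed

lemma S_power_le: "S ^ m \<le> S" if "0 < m"
  using power_decreasing[of 1 m S] that S_pos S_less by simp

lemma a_less_1: "a m < 1" if "0 < m"
  using a_plus_c[of m] c_nonneg[of m] S_power_le[OF that] S_less by linarith

lemma psi_0 [simp]: "psi 0 = 1"
  by (simp add: psi_def)

lemma psi_Suc: "psi (Suc m) = c (Suc m) / (1 - a (Suc m)) * psi m"
  by (simp add: psi_def mult.commute)

lemma psi_fixpoint: "psi (Suc m) = a (Suc m) * psi (Suc m) + c (Suc m) * psi m"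
  using a_less_1[of "Suc m"] by (simp add: psi_Suc field_simps)

lemma psi_bounds: "0 \<le> psi m \<and> psi m \<le> 1"
proof (induction m)
  case (Suc m)
  have "c (Suc m) / (1 - a (Suc m)) \<in> {0..1}"
    using c_nonneg[of "Suc m"] a_less_1[of "Suc m"] a_plus_c[of "Suc m"] S_power_le[of "Suc m"] S_less
    by (auto simp: field_simps)
  moreover have "0 \<le> psi m" "psi m \<le> 1" using Suc by auto
  ultimately show ?case
    unfolding psi_Suc atLeastAtMost_iff by (metis mult_nonneg_nonneg mult_le_one)
qed simp

lemma psi_n_pos: "0 < psi n"
  unfolding psi_def using S_pos Q_pos n_pos a_less_1
  by (intro prod_pos) (auto simp: c_def)

lemma psi_n_le: "psi n \<le> S ^ n"
proof -
  obtain m where n: "n = Suc m" using n_pos by (cases n) auto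
  have "psi n = c n * psi m"
    using psi_fixpoint[of m] by (simp flip: n)
  also have "\<dots> \<le> c n * 1"
    using psi_bounds c_nonneg by (intro mult_left_mono) auto
  also have "\<dots> \<le> S ^ n" using a_plus_c[of n] by simp
  finally show ?thesis .
qed

lemma Pop_cong: "Pop g k = Pop g' k" if "\<And>j. j \<le> n \<Longrightarrow> g j = g' j"
  using that by (simp add: Pop_def)

lemma Pop_linear: "Pop (\<lambda>k. x * g k + y * g' k) k = x * Pop g k + y * Pop g' k"
  by (simp add: Pop_def sum.distrib sum_distrib_left algebra_simps)

lemma Pop_pow_cong: "(Pop ^^ t) g k = (Pop ^^ t) g' k" if "\<And>j. j \<le> n \<Longrightarrow> g j = g' j" "k \<le> n"
  using that
proof (induction t arbitrary: k)
  case (Suc t)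
  show ?case
    unfolding funpow.simps o_apply by (rule Pop_cong) (use Suc in auto)
qed auto

lemma Pop_pow_phi_Suc:
  assumes "Suc m \<le> n" "k \<le> n"
  shows "(Pop ^^ Suc t) (phi (Suc m)) k
    = a (Suc m) * (Pop ^^ t) (phi (Suc m)) k + c (Suc m) * (Pop ^^ t) (phi m) k"
  using assms(2)
proof (induction t arbitrary: k)
  case 0
  then show ?case using assms by (simp add: Pop_phi_Suc)
next
  case (Suc t)
  have "(Pop ^^ Suc (Suc t)) (phi (Suc m)) k = Pop ((Pop ^^ Suc t) (phi (Suc m))) k"
    by simp
  also have "\<dots> = Pop (\<lambda>k. a (Suc m) * (Pop ^^ t) (phi (Suc m)) k + c (Suc m) * (Pop ^^ t) (phi m) k) k"
    by (rule Pop_cong) (rule Suc.IH)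
  finally show ?case
    by (simp add: Pop_linear)
qed

lemma Pop_pow_phi_0: "(Pop ^^ t) (phi 0) k = 1" if "k \<le> n"
  using that
proof (induction t arbitrary: k)
  case (Suc t)
  have "Pop ((Pop ^^ t) (phi 0)) k = Pop (phi 0) k"
    by (rule Pop_cong) (simp add: Suc.IH, simp add: phi_def)
  then show ?case using Suc Pop_phi_0 by simp
qed (simp add: phi_def)

text \<open>Subtracting \<open>psi_fixpoint\<close>, the new deviation combines two old ones with
  nonnegative weights of total at most \<open>S\<close>. Inducting on \<open>t\<close> for all
  \<open>m\<close> at once keeps the constant at 1, with no loss in \<open>m\<close>.\<close>

lemma Pop_pow_phi_close:
  assumes "m \<le> n" "k \<le> n"
  shows "\<bar>(Pop ^^ t) (phi m) k - psi m\<bar> \<le> S ^ t"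
  using assms
proof (induction t arbitrary: m)
  case 0
  then show ?case
    using phi_bounds[of k m] psi_bounds[of m] by auto
next
  case (Suc t)
  show ?case
  proof (cases m)
    case 0
    then show ?thesis using Pop_pow_phi_0[of k "Suc t"] Suc S_pos by simp
  next
    case m: (Suc l)
    have "(Pop ^^ Suc t) (phi m) k - psi m
        = a m * ((Pop ^^ t) (phi m) k - psi m) + c m * ((Pop ^^ t) (phi l) k - psi l)"
      using Pop_pow_phi_Suc[of l k t] psi_fixpoint[of l] Suc.prems unfolding m
      by (simp add: algebra_simps)
    also have "\<bar>\<dots>\<bar> \<le> a m * S ^ t + c m * S ^ t"
      using Suc.IH[of m] Suc.IH[of l] Suc.prems m a_nonneg[of m] c_nonneg[of m]
      by (intro order_trans[OF abs_triangle_ineq] add_mono) (auto simp: abs_mult intro!: mult_left_mono)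
    also have "\<dots> \<le> S * S ^ t"
      unfolding distrib_right[symmetric] using order_trans[OF a_plus_c[of m] S_power_le[of m]] m S_pos
      by (intro mult_right_mono) auto
    finally show ?thesis by simp
  qed
qed

lemma Pop_pow_phi_n_close:
  assumes "k \<le> n"
  shows "\<bar>(Pop ^^ Suc t) (phi n) k - psi n\<bar> \<le> S ^ (n + t)"
proof -
  obtain m where n: "n = Suc m" using n_pos by (cases n) auto
  have "(Pop ^^ Suc t) (phi n) k - psi n = c n * ((Pop ^^ t) (phi m) k - psi m)"
    using Pop_pow_phi_Suc[of m k t] psi_fixpoint[of m] assms
    by (simp add: right_diff_distrib flip: n)
  also have "\<bar>\<dots>\<bar> \<le> S ^ n * S ^ t"
    unfolding abs_mult
  proof (intro mult_mono)
    show "\<bar>c n\<bar> \<le> S ^ n" using a_plus_c[of n] c_nonneg[of n] by simp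
    show "\<bar>(Pop ^^ t) (phi m) k - psi m\<bar> \<le> S ^ t"
      by (rule Pop_pow_phi_close) (use assms n in auto)
  qed (use S_pos in auto)
  finally show ?thesis by (simp add: power_add)
qed

section \<open>Existence and uniqueness of the stationary law by inverting moments\<close>

definition dlt :: "nat \<Rightarrow> nat \<Rightarrow> real" where "dlt i k = (if k = i then 1 else 0)"

lemma Pop_pow_sum:
  "(Pop ^^ t) (\<lambda>k. \<Sum>i\<in>A. x i * g i k) = (\<lambda>k. \<Sum>i\<in>A. x i * (Pop ^^ t) (g i) k)"
proof (induction t)
  case (Suc t)
  have "Pop (\<lambda>k. \<Sum>i\<in>A. x i * (Pop ^^ t) (g i) k) k = (\<Sum>i\<in>A. x i * Pop ((Pop ^^ t) (g i)) k)" for k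
    unfolding Pop_def sum_distrib_left by (subst sum.swap) (simp add: mult_ac)
  then show ?case using Suc by simp
qed simp

lemma sum_choose_split:
  fixes x :: "nat \<Rightarrow> real"
  assumes "i \<le> n"
  shows "(\<Sum>j\<le>n. real (j choose i) * x j) = x i + (\<Sum>j\<in>{i<..n}. real (j choose i) * x j)"
proof -
  have "{..n} = {..<i} \<union> insert i {i<..n}"
    using assms by auto
  then have "(\<Sum>j\<le>n. real (j choose i) * x j)
      = (\<Sum>j\<in>{..<i} \<union> insert i {i<..n}. real (j choose i) * x j)" by simp
  also have "\<dots> = (\<Sum>j\<in>{..<i}. real (j choose i) * x j) + (\<Sum>j\<in>insert i {i<..n}. real (j choose i) * x j)"
    by (rule sum.union_disjoint) auto
  also have "(\<Sum>j\<in>{..<i}. real (j choose i) * x j) = 0"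
    by (intro sum.neutral) (auto simp: binomial_eq_0)
  finally show ?thesis by simp
qed

lemma Pop_pow_phi_dlt:
  assumes "i \<le> n" "k \<le> n"
  shows "real (n choose i) * (Pop ^^ t) (phi i) k = (\<Sum>j\<le>n. real (j choose i) * (Pop ^^ t) (dlt j) k)"
proof -
  define y where "y j = real (j choose i) / real (n choose i)" for j
  have "phi i k' = (\<Sum>j\<le>n. y j * dlt j k')" if "k' \<le> n" for k'
  proof -
    have "(\<Sum>j\<le>n. y j * dlt j k') = (\<Sum>j\<le>n. if j = k' then y j else 0)"
      by (intro sum.cong) (auto simp: dlt_def)
    then show ?thesis
      using that by (simp add: phi_def y_def)
  qed
  then have "(Pop ^^ t) (phi i) k
      = (Pop ^^ t) (\<lambda>k'. \<Sum>j\<le>n. y j * dlt j k') k"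
    using assms by (intro Pop_pow_cong) auto
  then show ?thesis
    unfolding Pop_pow_sum using choose_pos[OF assms(1)] by (simp add: sum_distrib_left y_def)
qed

lemma Pop_pow_phi_tendsto: "(\<lambda>t. (Pop ^^ t) (phi m) 0) \<longlonglongrightarrow> psi m" if "m \<le> n"
proof (rule LIM_zero_cancel, rule Lim_null_comparison)
  show "\<forall>\<^sub>F t in sequentially. norm ((Pop ^^ t) (phi m) 0 - psi m) \<le> S ^ t"
    using Pop_pow_phi_close[OF that] by simp
  show "(\<lambda>t. S ^ t) \<longlonglongrightarrow> 0"
    using S_pos S_less by (intro LIMSEQ_power_zero) auto
qed

text \<open>The moments form a triangular system in the point masses, solved from the top state downwards.\<close>

lemma convergent_Pop_pow_dlt: "convergent (\<lambda>t. (Pop ^^ t) (dlt i) 0)" if "i \<le> n"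
  using that
proof (induction "n - i" arbitrary: i rule: less_induct)
  case less
  have *: "(Pop ^^ t) (dlt i) 0 = real (n choose i) * (Pop ^^ t) (phi i) 0
      - (\<Sum>j\<in>{i<..n}. real (j choose i) * (Pop ^^ t) (dlt j) 0)" for t
    using Pop_pow_phi_dlt[of i 0 t] sum_choose_split[of i "\<lambda>j. (Pop ^^ t) (dlt j) 0"] less.prems by simp
  have conv: "convergent (\<lambda>t. (Pop ^^ t) (dlt j) 0)" if "j \<in> {i<..n}" for j
    using that less.prems by (intro less.hyps) auto
  have "convergent (\<lambda>t. real (n choose i) * (Pop ^^ t) (phi i) 0)"
    using Pop_pow_phi_tendsto[OF less.prems] by (intro convergent_mult convergent_const) (auto simp: convergent_def)
  moreover have "convergent (\<lambda>t. \<Sum>j\<in>{i<..n}. real (j choose i) * (Pop ^^ t) (dlt j) 0)"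
    using conv by (intro convergent_sum convergent_mult convergent_const)
  ultimately show ?case
    unfolding * by (rule convergent_diff)
qed

text \<open>The stationary law is built as the limit law of the chain started empty; it is invariant
  because a time shift does not change the limit (\<open>stat_balance\<close>).\<close>

definition stat :: "nat \<Rightarrow> real" where "stat i = lim (\<lambda>t. (Pop ^^ t) (dlt i) 0)"

lemma stat_tendsto: "(\<lambda>t. (Pop ^^ t) (dlt i) 0) \<longlonglongrightarrow> stat i" if "i \<le> n"
  unfolding stat_def using convergent_Pop_pow_dlt[OF that] by (simp add: convergent_LIMSEQ_iff)

lemma Pop_pow_nonneg: "0 \<le> (Pop ^^ t) (dlt i) k"
  by (induction t arbitrary: k) (auto simp: dlt_def Pop_def intro!: sum_nonneg)

lemma stat_nonneg: "0 \<le> stat i" if "i \<le> n"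
  by (rule LIMSEQ_le_const[OF stat_tendsto[OF that]]) (auto intro: Pop_pow_nonneg)

lemma sum_stat: "(\<Sum>i\<le>n. stat i) = 1"
proof -
  have "(\<lambda>t. \<Sum>i\<le>n. (Pop ^^ t) (dlt i) 0) \<longlonglongrightarrow> (\<Sum>i\<le>n. stat i)"
    by (intro tendsto_sum stat_tendsto) auto
  moreover have "(\<Sum>i\<le>n. (Pop ^^ t) (dlt i) 0) = 1" for t
    using Pop_pow_phi_dlt[of 0 0 t] Pop_pow_phi_0[of 0 t] by simp
  ultimately show ?thesis
    by (simp add: LIMSEQ_const_iff)
qed

lemma stat_balance: "(\<Sum>j\<le>n. stat j * P j i) = stat i" if "i \<le> n"
proof -
  have "(Pop ^^ Suc t) (dlt i) 0 = (\<Sum>j\<le>n. P j i * (Pop ^^ t) (dlt j) 0)" for t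
  proof -
    \<comment> \<open>The last transition is split off, not the first: as a function of its starting
      point it is a column of \<open>P\<close>, which is then expanded in the indicators
      \<open>dlt j\<close>.\<close>
    have "(Pop ^^ Suc t) (dlt i) 0 = (Pop ^^ t) (Pop (dlt i)) 0"
      by (simp add: funpow_swap1)
    also have "\<dots> = (Pop ^^ t) (\<lambda>k. \<Sum>j\<le>n. P j i * dlt j k) 0"
    proof (rule Pop_pow_cong)
      fix k assume "k \<le> n"
      have "Pop (dlt i) k = (\<Sum>j\<le>n. if j = i then P k j else 0)"
        unfolding Pop_def dlt_def by (intro sum.cong) auto
      moreover have "(\<Sum>j\<le>n. P j i * dlt j k) = (\<Sum>j\<le>n. if j = k then P j i else 0)"
        unfolding dlt_def by (intro sum.cong) auto
      ultimately show "Pop (dlt i) k = (\<Sum>j\<le>n. P j i * dlt j k)"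
        using \<open>k \<le> n\<close> \<open>i \<le> n\<close> by simp
    qed simp
    finally show ?thesis by (simp add: Pop_pow_sum)
  qed
  moreover have "(\<lambda>t. \<Sum>j\<le>n. P j i * (Pop ^^ t) (dlt j) 0) \<longlonglongrightarrow> (\<Sum>j\<le>n. P j i * stat j)"
    by (intro tendsto_sum tendsto_mult tendsto_const stat_tendsto) auto
  moreover have "(\<lambda>t. (Pop ^^ Suc t) (dlt i) 0) \<longlonglongrightarrow> stat i"
    by (rule LIMSEQ_Suc[OF stat_tendsto[OF that]])
  ultimately have "(\<Sum>j\<le>n. P j i * stat j) = stat i"
    using LIMSEQ_unique by auto
  then show ?thesis by (simp add: mult.commute)
qed

lemma pmf_bind_kernel:
  assumes "set_pmf \<nu> \<subseteq> {0..n}"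
  shows "pmf (bind_pmf \<nu> (cc_kernel Q S n)) i = (\<Sum>k\<le>n. pmf \<nu> k * P k i)"
  unfolding pmf_bind using assms by (subst integral_measure_pmf[of "{..n}"]) auto

lemma P_eq_0: "P k i = 0" if "k \<le> n" "n < i"
  using set_kernel[OF that(1)] that(2) by (auto simp: pmf_eq_0_set_pmf)

lemma sum_P: "(\<Sum>j\<le>n. P k j) = 1" if "k \<le> n"
  using set_kernel[OF that] by (intro sum_pmf_eq_1) auto

lemma ex_stationary: "\<exists>\<nu>. cc_stationary Q S n \<nu>"
proof -
  define g where "g i = (if i \<le> n then stat i else 0)" for i
  define \<nu> where "\<nu> = embed_pmf g"
  have g_nonneg: "0 \<le> g i" for i
    by (simp add: g_def stat_nonneg)
  have "(\<integral>\<^sup>+x. ennreal (g x) \<partial>count_space UNIV) = (\<Sum>x\<le>n. ennreal (g x))"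
    by (intro nn_integral_count_space') (auto simp: g_def)
  also have "\<dots> = ennreal (\<Sum>x\<le>n. stat x)"
  proof -
    have "(\<Sum>x\<le>n. g x) = (\<Sum>x\<le>n. stat x)"
      by (simp add: g_def)
    then show ?thesis
      by (simp add: g_nonneg)
  qed
  finally have "(\<integral>\<^sup>+x. ennreal (g x) \<partial>count_space UNIV) = 1"
    by (simp add: sum_stat)
  with g_nonneg have pmf: "pmf \<nu> i = g i" for i
    unfolding \<nu>_def by (intro pmf_embed_pmf)
  have set: "set_pmf \<nu> \<subseteq> {0..n}"
    by (auto simp: set_pmf_iff pmf g_def split: if_splits)
  have "bind_pmf \<nu> (cc_kernel Q S n) = \<nu>"
  proof (rule pmf_eqI)
    show "pmf (bind_pmf \<nu> (cc_kernel Q S n)) i = pmf \<nu> i" for i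
      unfolding pmf_bind_kernel[OF set] by (cases "i \<le> n") (auto simp: pmf g_def stat_balance P_eq_0)
  qed
  with set show ?thesis
    by (auto simp: cc_stationary_def)
qed

text \<open>Invariance gives the stationary moments the recursion of \<open>psi_fixpoint\<close>,
  and \<open>a (Suc m) < 1\<close> makes its solution unique.\<close>

lemma stationary_moment:
  assumes "cc_stationary Q S n \<nu>" "m \<le> n"
  shows "(\<Sum>k\<le>n. pmf \<nu> k * phi m k) = psi m"
  using assms(2)
proof (induction m)
  case 0
  have "(\<Sum>k\<le>n. pmf \<nu> k) = 1"
    using assms by (intro sum_pmf_eq_1) (auto simp: cc_stationary_def)
  then show ?case by (simp add: phi_def)
next
  case (Suc m)
  have inv: "pmf \<nu> j = (\<Sum>k\<le>n. pmf \<nu> k * P k j)" for j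
    using assms pmf_bind_kernel[of \<nu> j] by (auto simp: cc_stationary_def)
  define M where "M = (\<Sum>k\<le>n. pmf \<nu> k * phi (Suc m) k)"
  have "M = (\<Sum>j\<le>n. (\<Sum>k\<le>n. pmf \<nu> k * P k j) * phi (Suc m) j)"
    unfolding M_def by (subst inv) (rule refl)
  also have "\<dots> = (\<Sum>k\<le>n. pmf \<nu> k * Pop (phi (Suc m)) k)"
    unfolding Pop_def sum_distrib_left sum_distrib_right by (subst sum.swap) (simp add: mult_ac)
  also have "\<dots> = (\<Sum>k\<le>n. a (Suc m) * (pmf \<nu> k * phi (Suc m) k) + c (Suc m) * (pmf \<nu> k * phi m k))"
    using Suc.prems by (intro sum.cong) (auto simp: Pop_phi_Suc algebra_simps)
  also have "\<dots> = a (Suc m) * M + c (Suc m) * psi m"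
    using Suc by (simp add: sum.distrib M_def flip: sum_distrib_left)
  finally have "M * (1 - a (Suc m)) = psi (Suc m) * (1 - a (Suc m))"
    using psi_fixpoint[of m] by (simp add: algebra_simps)
  then show ?case
    using a_less_1[of "Suc m"] by (simp add: M_def)
qed

text \<open>A law on \<open>{0..n}\<close> is determined by its factorial moments of orders 0 to
  \<open>n\<close>: the system is triangular with unit diagonal, so the point masses agree from
  state \<open>n\<close> downwards.\<close>

lemma stationary_unique:
  assumes "cc_stationary Q S n \<nu>" "cc_stationary Q S n \<nu>'"
  shows "\<nu> = \<nu>'"
proof (rule pmf_eqI)
  have moment: "(\<Sum>j\<le>n. real (j choose i) * pmf \<rho> j) = real (n choose i) * psi i"
    if "cc_stationary Q S n \<rho>" "i \<le> n" for \<rho> i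
    using stationary_moment[OF that] choose_pos[OF that(2)]
    by (simp add: phi_def sum_divide_distrib[symmetric] field_simps)
  have le: "pmf \<nu> i = pmf \<nu>' i" if "i \<le> n" for i
    using that
  proof (induction "n - i" arbitrary: i rule: less_induct)
    case less
    have "(\<Sum>j\<in>{i<..n}. real (j choose i) * pmf \<nu> j) = (\<Sum>j\<in>{i<..n}. real (j choose i) * pmf \<nu>' j)"
      using less by (intro sum.cong) auto
    then show ?case
      using moment[OF assms(1) less.prems] moment[OF assms(2) less.prems]
        sum_choose_split[OF less.prems, of "pmf \<nu>"] sum_choose_split[OF less.prems, of "pmf \<nu>'"]
      by linarith
  qed
  show "pmf \<nu> i = pmf \<nu>' i" for i
  proof (cases "i \<le> n")
    case False
    then have "i \<notin> set_pmf \<nu>" "i \<notin> set_pmf \<nu>'"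
      using assms by (auto simp: cc_stationary_def)
    then show ?thesis by (simp add: set_pmf_iff)
  qed (rule le)
qed

lemma cc_nu_stationary: "cc_stationary Q S n (cc_nu Q S n)"
  unfolding cc_nu_def using ex_stationary stationary_unique by (metis theI)

lemma cc_nu_top: "pmf (cc_nu Q S n) n = psi n"
proof -
  have "(\<Sum>k\<le>n. pmf (cc_nu Q S n) k * phi n k) = (\<Sum>k\<le>n. if k = n then pmf (cc_nu Q S n) k else 0)"
    by (intro sum.cong) (auto simp: phi_n)
  then show ?thesis
    using stationary_moment[OF cc_nu_stationary, of n] by simp
qed

text \<open>Balance at \<open>n\<close>: the stationary mass \<open>psi n\<close> either enters from
  below, which is \<open>cc_mu\<close>, or was already there and stayed.\<close>

lemma cc_mu_eq: "cc_mu Q S n = psi n * (1 - P n n)"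
proof -
  have "pmf (cc_nu Q S n) n = (\<Sum>k\<le>n. pmf (cc_nu Q S n) k * P k n)"
    using cc_nu_stationary pmf_bind_kernel[of "cc_nu Q S n" n] by (auto simp: cc_stationary_def)
  then show ?thesis
    by (simp add: cc_mu_def cc_nu_top algebra_simps flip: lessThan_Suc_atMost)
qed

lemma Pop_phi_n: "Pop (phi n) k = P k n"
proof -
  have "Pop (phi n) k = (\<Sum>j\<le>n. if j = n then P k j else 0)"
    unfolding Pop_def by (intro sum.cong) (auto simp: phi_n)
  then show ?thesis by simp
qed

section \<open>First passage to the full state\<close>

lemma hit_nonneg: "0 \<le> cc_hit Q S n t k"
  by (induction Q S n t k rule: cc_hit.induct) (auto intro!: sum_nonneg)

lemma sum_P_split: "(\<Sum>j<n. P k j) + P k n = 1" if "k \<le> n"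
  using sum_P[OF that] by (simp flip: lessThan_Suc_atMost)

text \<open>First-step analysis with a free weight \<open>x\<close>: a constant weight yields
  \<open>hit_mass\<close>, the occupation probabilities after the passage yield
  \<open>hit_renewal\<close>.\<close>

lemma hit_Suc_Suc_sum:
  "(\<Sum>s\<le>Suc t. cc_hit Q S n s k * x s)
    = P k n * x (Suc 0) + (\<Sum>j<n. P k j * (\<Sum>s\<le>t. cc_hit Q S n s j * x (Suc s)))"
proof -
  have *: "cc_hit Q S n (Suc s) k * y = (if s = 0 then P k n * y else 0) + (\<Sum>j<n. P k j * (cc_hit Q S n s j * y))"
    for s y
    by (cases s) (auto simp: sum_distrib_left sum_distrib_right mult_ac)
  have "(\<Sum>s\<le>Suc t. cc_hit Q S n s k * x s) = (\<Sum>s\<le>t. cc_hit Q S n (Suc s) k * x (Suc s))"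
    unfolding sum.atMost_Suc_shift by simp
  also have "\<dots> = P k n * x (Suc 0) + (\<Sum>s\<le>t. \<Sum>j<n. P k j * (cc_hit Q S n s j * x (Suc s)))"
    unfolding * by (simp add: sum.distrib)
  also have "(\<Sum>s\<le>t. \<Sum>j<n. P k j * (cc_hit Q S n s j * x (Suc s)))
      = (\<Sum>j<n. P k j * (\<Sum>s\<le>t. cc_hit Q S n s j * x (Suc s)))"
    by (subst sum.swap) (simp add: sum_distrib_left)
  finally show ?thesis .
qed

lemma hit_mass: "(\<Sum>s\<le>t. cc_hit Q S n s k) \<le> 1" if "k \<le> n"
  using that
proof (induction t arbitrary: k)
  case (Suc t)
  have "(\<Sum>s\<le>Suc t. cc_hit Q S n s k) = P k n + (\<Sum>j<n. P k j * (\<Sum>s\<le>t. cc_hit Q S n s j))"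
    using hit_Suc_Suc_sum[where k = k and t = t and x = "\<lambda>_. 1"] by simp
  also have "\<dots> \<le> P k n + (\<Sum>j<n. P k j * 1)"
    using Suc.IH by (intro add_left_mono sum_mono mult_left_mono) auto
  finally show ?case
    using sum_P_split[OF Suc.prems] by simp
qed simp

text \<open>The start must lie below \<open>n\<close>: \<open>cc_hit\<close> puts no mass on time 0,
  while a chain started in \<open>n\<close> is there at time 0.\<close>

lemma hit_renewal:
  assumes "k < n"
  shows "(Pop ^^ t) (phi n) k = (\<Sum>s\<le>t. cc_hit Q S n s k * (Pop ^^ (t - s)) (phi n) n)"
  using assms
proof (induction t arbitrary: k)
  case 0
  then show ?case by (simp add: phi_n)
next
  case (Suc t)
  have "(Pop ^^ Suc t) (phi n) k = P k n * (Pop ^^ t) (phi n) n + (\<Sum>j<n. P k j * (Pop ^^ t) (phi n) j)"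
    by (simp add: Pop_def flip: lessThan_Suc_atMost)
  also have "(\<Sum>j<n. P k j * (Pop ^^ t) (phi n) j)
      = (\<Sum>j<n. P k j * (\<Sum>s\<le>t. cc_hit Q S n s j * (Pop ^^ (t - s)) (phi n) n))"
    using Suc.IH by simp
  finally show ?case
    using hit_Suc_Suc_sum[where k = k and t = t and x = "\<lambda>s. (Pop ^^ (Suc t - s)) (phi n) n"] by simp
qed

end

section \<open>Limits\<close>

text \<open>The two polynomials share their leading term. Bounding the difference by the previous
  rising factorial keeps the error inside the family whose moments are known.\<close>

lemma pochhammer_minus_power:
  "\<exists>C. \<forall>x::real. x \<ge> 1 \<longrightarrow> 0 \<le> pochhammer x (Suc r) - x ^ Suc r \<and>
      pochhammer x (Suc r) - x ^ Suc r \<le> C * pochhammer x r"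
proof (induction r)
  case 0
  show ?case by (intro exI[of _ 0]) simp
next
  case (Suc r)
  then obtain C where C: "0 \<le> pochhammer x (Suc r) - x ^ Suc r"
      "pochhammer x (Suc r) - x ^ Suc r \<le> C * pochhammer x r" if "x \<ge> 1" for x :: real
    by blast
  \<comment> \<open>The induction hypothesis does not record the sign of \<open>C\<close>; it is
    read off at x = 1, where the rising factorial is positive.\<close>
  have C_nonneg: "0 \<le> C"
  proof -
    have "0 \<le> C * pochhammer 1 r"
      using order_trans[OF C[of 1]] by simp
    then show ?thesis
      using pochhammer_pos[of "1::real" r] by (simp add: zero_le_mult_iff)
  qed
  show ?case
  proof (intro exI[of _ "real (Suc r) + C"] allI impI)
    fix x :: real assume x: "1 \<le> x"
    define p where "p = pochhammer x r"
    have p: "0 \<le> p" "pochhammer x (Suc r) = p * (x + real r)"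
      using x by (auto simp: p_def pochhammer_Suc intro!: less_imp_le pochhammer_pos)
    have eq: "pochhammer x (Suc (Suc r)) - x ^ Suc (Suc r)
        = real (Suc r) * pochhammer x (Suc r) + x * (pochhammer x (Suc r) - x ^ Suc r)"
      by (simp add: pochhammer_Suc algebra_simps)
    have "x * (pochhammer x (Suc r) - x ^ Suc r) \<le> x * (C * p)"
      using C[OF x] x by (intro mult_left_mono) (auto simp: p_def)
    also have "\<dots> \<le> C * (p * (x + real r))"
      using C_nonneg p x by (simp add: algebra_simps)
    finally have "x * (pochhammer x (Suc r) - x ^ Suc r) \<le> C * pochhammer x (Suc r)"
      using p by simp
    moreover have "0 \<le> x * (pochhammer x (Suc r) - x ^ Suc r)" "0 \<le> pochhammer x (Suc r)"
      using C[OF x] x p by auto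
    ultimately show "0 \<le> pochhammer x (Suc (Suc r)) - x ^ Suc (Suc r) \<and>
      pochhammer x (Suc (Suc r)) - x ^ Suc (Suc r) \<le> (real (Suc r) + C) * pochhammer x (Suc r)"
      unfolding eq distrib_right by simp
  qed
qed

lemma rising_weight_pochhammer:
  "fact (Suc r) * rising_weight (Suc r) t = pochhammer (real (Suc t)) (Suc r)"
proof -
  have "rising_weight (Suc r) t = (real t + real (Suc r)) gchoose (Suc r)"
    by (simp only: rising_weight_def binomial_gbinomial of_nat_add)
  also have "\<dots> = pochhammer (real (Suc t)) (Suc r) / fact (Suc r)"
    unfolding gbinomial_pochhammer' by (simp add: add.commute)
  finally show ?thesis by simp
qed

text \<open>Factor \<open>i\<close> exceeds \<open>1 - S ^ i\<close> by i S^i / n. The relative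
  increments sum to at most C / n, so the product lies between the partial product of
  \<open>qpoch_inf\<close> and \<open>exp (C / n)\<close> times it.\<close>

lemma prod_one_minus_tendsto_qpoch:
  fixes S :: real
  assumes "0 < S" "S < 1"
  shows "(\<lambda>n. \<Prod>i=1..n. 1 - S ^ i * (1 - real i / real n)) \<longlonglongrightarrow> qpoch_inf S" "0 < qpoch_inf S"
proof -
  have geo: "summable (\<lambda>i. S ^ Suc i)"
    using assms by (subst summable_Suc_iff) (auto intro: summable_geometric)
  have lt: "S ^ Suc i < 1" for i
    using assms by (intro power_Suc_less_one) auto
  have "convergent_prod (\<lambda>i. 1 - S ^ Suc i)"
  proof -
    have "summable (\<lambda>i. norm ((1 - S ^ Suc i) - 1))"
      using geo assms by simp
    then show ?thesis
      by (intro abs_convergent_prod_imp_convergent_prod summable_imp_abs_convergent_prod)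
  qed
  note conv = this
  show pos: "0 < qpoch_inf S"
    unfolding qpoch_inf_def using lt
    by (intro less_0_prodinf[OF conv]) (simp add: less_diff_eq)
  have lim: "(\<lambda>n. \<Prod>i=1..n. 1 - S ^ i) \<longlonglongrightarrow> qpoch_inf S"
  proof -
    have "(\<lambda>n. \<Prod>i<n. 1 - S ^ Suc i) \<longlonglongrightarrow> qpoch_inf S"
      unfolding qpoch_inf_def LIMSEQ_lessThan_iff_atMost by (rule convergent_prod_LIMSEQ[OF conv])
    moreover have "(\<Prod>i=1..n. 1 - S ^ i) = (\<Prod>i<n. 1 - S ^ Suc i)" for n
      by (rule prod.reindex_bij_witness[of _ Suc "\<lambda>i. i - 1"]) auto
    ultimately show ?thesis by simp
  qed
  have "summable (\<lambda>i. rising_weight 1 i * S ^ i)"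
    by (rule summable_rising_weight_geometric[OF assms])
  then have "summable (\<lambda>i. S * (rising_weight 1 i * S ^ i))"
    by (rule summable_mult)
  then have summ: "summable (\<lambda>i. real (Suc i) * S ^ Suc i)"
    by (simp add: rising_weight_def mult_ac)
  define C where "C = (\<Sum>i. real (Suc i) * S ^ Suc i) / (1 - S)"
  have C: "(\<Sum>i=1..n. real i * S ^ i) / (1 - S) \<le> C" for n
  proof -
    have "(\<Sum>i=1..n. real i * S ^ i) = (\<Sum>i<n. real (Suc i) * S ^ Suc i)"
      by (rule sum.reindex_bij_witness[of _ Suc "\<lambda>i. i - 1"]) auto
    also have "\<dots> \<le> (\<Sum>i. real (Suc i) * S ^ Suc i)"
      using assms by (intro sum_le_suminf summ) auto
    finally show ?thesis
      using assms by (simp add: C_def divide_right_mono)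
  qed
  have S_pow: "S ^ i \<le> S" if "i \<ge> 1" for i
    using power_decreasing[of 1 i S] that assms by simp
  show "(\<lambda>n. \<Prod>i=1..n. 1 - S ^ i * (1 - real i / real n)) \<longlonglongrightarrow> qpoch_inf S"
  proof (rule tendsto_sandwich)
    show "(\<lambda>n. \<Prod>i=1..n. 1 - S ^ i) \<longlonglongrightarrow> qpoch_inf S" by (rule lim)
    have "(\<lambda>n. exp (C / real n) * (\<Prod>i=1..n. 1 - S ^ i)) \<longlonglongrightarrow> exp 0 * qpoch_inf S"
      by (intro tendsto_intros lim lim_const_over_n)
    then show "(\<lambda>n. exp (C / real n) * (\<Prod>i=1..n. 1 - S ^ i)) \<longlonglongrightarrow> qpoch_inf S" by simp
    show "\<forall>\<^sub>F n in sequentially. (\<Prod>i=1..n. 1 - S ^ i) \<le> (\<Prod>i=1..n. 1 - S ^ i * (1 - real i / real n))"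
    proof (intro always_eventually allI prod_mono conjI)
      fix n i :: nat assume i: "i \<in> {1..n}"
      show "0 \<le> 1 - S ^ i" using S_pow[of i] i assms by auto
      show "1 - S ^ i \<le> 1 - S ^ i * (1 - real i / real n)"
        using assms by (simp add: algebra_simps)
    qed
    show "\<forall>\<^sub>F n in sequentially. (\<Prod>i=1..n. 1 - S ^ i * (1 - real i / real n))
        \<le> exp (C / real n) * (\<Prod>i=1..n. 1 - S ^ i)"
    proof (intro always_eventually allI)
      fix n :: nat
      have "(\<Prod>i=1..n. 1 - S ^ i * (1 - real i / real n))
          \<le> (\<Prod>i=1..n. exp (real i * S ^ i / (1 - S) / real n) * (1 - S ^ i))"
      proof (intro prod_mono conjI)
        fix i assume i: "i \<in> {1..n}"
        have Si: "S ^ i \<le> S" using S_pow i by auto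
        have "S ^ i * (1 - real i / real n) \<le> 1 * 1"
          using Si assms i by (intro mult_mono) auto
        then show "0 \<le> 1 - S ^ i * (1 - real i / real n)" by simp
        define y where "y = real i * S ^ i / real n"
        have y: "0 \<le> y" using assms by (simp add: y_def)
        have "1 - S ^ i * (1 - real i / real n) = (1 - S ^ i) + y"
          by (simp add: y_def algebra_simps)
        \<comment> \<open>All factors \<open>1 - S ^ i\<close> are at least \<open>1 - S\<close>,
          which makes the increment relative to its factor; this is the source of the division by
          \<open>1 - S\<close> in \<open>C\<close>.\<close>
        also have "y \<le> y / (1 - S) * (1 - S ^ i)"
        proof -
          have "y * (1 - S) \<le> y * (1 - S ^ i)"
            using y Si by (intro mult_left_mono) auto
          then show ?thesis using assms by (simp add: field_simps)
        qed
        also have "(1 - S ^ i) + y / (1 - S) * (1 - S ^ i) = (1 + y / (1 - S)) * (1 - S ^ i)"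
          by (simp add: algebra_simps)
        also have "\<dots> \<le> exp (y / (1 - S)) * (1 - S ^ i)"
          using Si assms by (intro mult_right_mono exp_ge_add_one_self) auto
        finally show "1 - S ^ i * (1 - real i / real n) \<le> exp (real i * S ^ i / (1 - S) / real n) * (1 - S ^ i)"
          by (simp add: y_def mult.commute)
      qed
      also have "\<dots> = exp ((\<Sum>i=1..n. real i * S ^ i) / (1 - S) / real n) * (\<Prod>i=1..n. 1 - S ^ i)"
        by (simp add: prod.distrib exp_sum sum_divide_distrib)
      also have "\<dots> \<le> exp (C / real n) * (\<Prod>i=1..n. 1 - S ^ i)"
      proof (intro mult_right_mono prod_nonneg)
        show "exp ((\<Sum>i=1..n. real i * S ^ i) / (1 - S) / real n) \<le> exp (C / real n)"
          unfolding exp_le_cancel_iff by (intro divide_right_mono C) simp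
        show "0 \<le> 1 - S ^ i" if "i \<in> {1..n}" for i
          using S_pow[of i] that assms by auto
      qed
      finally show "(\<Prod>i=1..n. 1 - S ^ i * (1 - real i / real n))
        \<le> exp (C / real n) * (\<Prod>i=1..n. 1 - S ^ i)" .
    qed
  qed
qed

section \<open>The collector as a renewal sequence\<close>

context cc_chain begin

text \<open>The target is \<open>n\<close>, the start is 0. The error constant has exponent n - 1
  because \<open>Pop_pow_phi_n_close\<close> gives \<open>S ^ (n + t)\<close> at time
  \<open>Suc t\<close>, where the locale already supplies \<open>S ^ Suc t\<close>.\<close>

sublocale ren: renewal_sequence "cc_T Q S n" "\<lambda>t. (Pop ^^ t) (phi n) n" "\<lambda>t. (Pop ^^ t) (phi n) 0"
  "psi n" "S ^ (n - 1)" S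
proof
  fix t
  have pow: "S ^ (n - 1) * S ^ Suc t = S ^ (n + t)"
    using n_pos by (cases n) (simp_all add: power_add)
  show "\<bar>(Pop ^^ Suc t) (phi n) n - psi n\<bar> \<le> S ^ (n - 1) * S ^ Suc t"
    "\<bar>(Pop ^^ Suc t) (phi n) 0 - psi n\<bar> \<le> S ^ (n - 1) * S ^ Suc t"
    unfolding pow by (rule Pop_pow_phi_n_close; simp)+
  show "(Pop ^^ t) (phi n) 0 = (\<Sum>s\<le>t. cc_T Q S n s * (Pop ^^ (t - s)) (phi n) n)"
    unfolding cc_T_def by (rule hit_renewal[OF n_pos])
  show "(\<Sum>s\<le>t. cc_T Q S n s) \<le> 1"
    unfolding cc_T_def by (rule hit_mass) simp
qed (use psi_n_pos psi_bounds S_pos S_less in \<open>auto simp: cc_T_def hit_nonneg phi_n\<close>)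

definition V :: "nat \<Rightarrow> real" where "V r = (\<Sum>t. pochhammer (real t) r * cc_T Q S n t)"

lemma cc_T_sums: "cc_T Q S n sums 1"
proof -
  have "(\<lambda>t. 1 - ren.h t) \<longlonglongrightarrow> 1 - 0"
    by (intro tendsto_diff tendsto_const ren.h_tendsto_0)
  then have "(\<lambda>t. \<Sum>s\<le>t. cc_T Q S n s) \<longlonglongrightarrow> 1"
    by (simp add: ren.h_def)
  then show ?thesis
    by (simp add: sums_def_le)
qed

lemma pochhammer_moment_sums:
  "(\<lambda>t. pochhammer (real t) (Suc r) * cc_T Q S n t) sums (fact (Suc r) * ren.B r)"
proof -
  have "(\<lambda>t. fact (Suc r) * (rising_weight (Suc r) t * cc_T Q S n (Suc t))) sums (fact (Suc r) * ren.B r)"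
    by (rule sums_mult[OF ren.rising_moment_sums])
  then have "(\<lambda>t. pochhammer (real (Suc t)) (Suc r) * cc_T Q S n (Suc t)) sums (fact (Suc r) * ren.B r)"
    unfolding mult.assoc[symmetric] rising_weight_pochhammer .
  then show ?thesis
    by (subst (asm) sums_Suc_iff) (simp add: ren.f_0)
qed

lemma V_0: "V 0 = 1"
  using cc_T_sums by (simp add: V_def sums_iff)

lemma V_Suc: "V (Suc r) = fact (Suc r) * ren.B r"
  using pochhammer_moment_sums[of r] by (simp add: V_def sums_iff)

lemma summable_pochhammer: "summable (\<lambda>t. pochhammer (real t) r * cc_T Q S n t)"
  using cc_T_sums pochhammer_moment_sums by (cases r) (auto simp: sums_iff)

text \<open>The polynomial comparison holds from 1 on; time 0 is treated apart, where
  \<open>cc_T\<close> vanishes.\<close>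

lemma power_moment_bounds:
  assumes C: "\<And>x::real. x \<ge> 1 \<Longrightarrow> 0 \<le> pochhammer x (Suc r) - x ^ Suc r \<and>
      pochhammer x (Suc r) - x ^ Suc r \<le> C * pochhammer x r"
  shows "summable (\<lambda>t. real t ^ Suc r * cc_T Q S n t)"
    and "(\<Sum>t. real t ^ Suc r * cc_T Q S n t) \<le> V (Suc r)"
    and "V (Suc r) - C * V r \<le> (\<Sum>t. real t ^ Suc r * cc_T Q S n t)"
proof -
  have upper: "real t ^ Suc r * cc_T Q S n t \<le> pochhammer (real t) (Suc r) * cc_T Q S n t" for t
  proof (cases "t = 0")
    case False
    then show ?thesis
      using C[of "real t"] by (intro mult_right_mono ren.f_nonneg) auto
  qed (simp add: ren.f_0)
  have lower: "pochhammer (real t) (Suc r) * cc_T Q S n t - C * (pochhammer (real t) r * cc_T Q S n t)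
      \<le> real t ^ Suc r * cc_T Q S n t" for t
  proof (cases "t = 0")
    case False
    then have "(pochhammer (real t) (Suc r) - C * pochhammer (real t) r) * cc_T Q S n t
      \<le> real t ^ Suc r * cc_T Q S n t"
      using C[of "real t"] by (intro mult_right_mono ren.f_nonneg) auto
    then show ?thesis by (simp only: left_diff_distrib mult.assoc)
  qed (simp add: ren.f_0)
  show sm: "summable (\<lambda>t. real t ^ Suc r * cc_T Q S n t)"
  proof (rule summable_comparison_test'[OF summable_pochhammer[of "Suc r"]])
    fix t
    have "0 \<le> real t ^ Suc r * cc_T Q S n t"
      by (intro mult_nonneg_nonneg ren.f_nonneg) simp
    then show "norm (real t ^ Suc r * cc_T Q S n t) \<le> pochhammer (real t) (Suc r) * cc_T Q S n t"
      using upper[of t] unfolding real_norm_def by linarith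
  qed
  show "(\<Sum>t. real t ^ Suc r * cc_T Q S n t) \<le> V (Suc r)"
    unfolding V_def by (rule suminf_le[OF upper sm summable_pochhammer])
  have "(\<lambda>t. pochhammer (real t) (Suc r) * cc_T Q S n t - C * (pochhammer (real t) r * cc_T Q S n t))
      sums (V (Suc r) - C * V r)"
    unfolding V_def by (intro sums_diff sums_mult summable_sums summable_pochhammer)
  then show "V (Suc r) - C * V r \<le> (\<Sum>t. real t ^ Suc r * cc_T Q S n t)"
    by (rule sums_le[OF lower _ summable_sums[OF sm]])
qed

lemma psi_eq: "psi n = fact n / real n ^ n * Q ^ n * S ^ (n * (n + 1) div 2)
    / (\<Prod>i=1..n. 1 - S ^ i * (1 - real i / real n))"
proof -
  have "(\<Prod>i=1..n. c i) = (\<Prod>i=1..n. S ^ i) * Q ^ n * (fact n / real n ^ n)"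
    by (simp add: c_def prod.distrib prod_dividef fact_prod)
  also have "(\<Prod>i=1..n. S ^ i) = S ^ (\<Sum>i=1..n. i)"
    by (simp add: power_sum)
  also have "(\<Sum>i=1..n. i) = n * (n + 1) div 2"
    using gauss_sum_from_Suc_0[of n, where 'a = nat] by simp
  finally show ?thesis
    by (simp add: psi_def prod_dividef a_def mult_ac)
qed

lemma return_le: "P n n \<le> 2 * S ^ n"
  using Pop_pow_phi_n_close[of n 0] psi_n_le Pop_phi_n[of n] by (simp add: abs_le_iff)

end

text \<open>Leaves \<open>n\<close> free, so that quantities of the chains become sequences in
  \<open>n\<close>; each single chain is reached through \<open>chain\<close>.\<close>

locale cc_params =
  fixes Q S :: real
  assumes Q_pos: "0 < Q" and Q_le: "Q \<le> 1" and S_pos: "0 < S" and S_less: "S < 1"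
begin

lemma chain: "cc_chain Q S n" if "0 < n"
  using that Q_pos Q_le S_pos S_less by unfold_locales

definition nu :: "nat \<Rightarrow> real" where "nu n = cc_chain.psi Q S n n"
definition BB :: "nat \<Rightarrow> nat \<Rightarrow> real" where "BB n r = renewal_sequence.B (cc_T Q S n) r"
definition M :: "nat \<Rightarrow> nat \<Rightarrow> real" where "M n r = (\<Sum>t. real t ^ r * cc_T Q S n t)"

lemma S_pow_tendsto: "(\<lambda>n. S ^ n) \<longlonglongrightarrow> 0"
  using S_pos S_less by (intro LIMSEQ_power_zero) auto

lemma S_pow_pred_tendsto: "(\<lambda>n. S ^ (n - 1)) \<longlonglongrightarrow> 0"
  by (rule LIMSEQ_imp_Suc) (simp add: S_pow_tendsto)

lemma nu_pos: "0 < nu n" if "0 < n"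
  unfolding nu_def by (rule cc_chain.psi_n_pos[OF chain[OF that]])

lemma nu_tendsto_0: "nu \<longlonglongrightarrow> 0"
proof (rule Lim_null_comparison[OF _ S_pow_tendsto])
  show "\<forall>\<^sub>F n in sequentially. norm (nu n) \<le> S ^ n"
    using eventually_gt_at_top[of 0]
  proof eventually_elim
    case (elim n)
    then show ?case
      using cc_chain.psi_n_le[OF chain[OF elim]] nu_pos[OF elim] by (simp add: nu_def)
  qed
qed

text \<open>The ratio is the probability of leaving the full state in one step. Limits are proved on
  the scale \<open>nu\<close> and carried over to \<open>cc_mu\<close> by this ratio.\<close>

lemma mu_over_nu: "(\<lambda>n. cc_mu Q S n / nu n) \<longlonglongrightarrow> 1"
proof -
  have "(\<lambda>n. 1 - pmf (cc_kernel Q S n n) n) \<longlonglongrightarrow> 1 - 0"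
  proof (intro tendsto_diff tendsto_const, rule Lim_null_comparison)
    show "(\<lambda>n. 2 * S ^ n) \<longlonglongrightarrow> 0"
      using tendsto_mult[OF tendsto_const S_pow_tendsto, of 2] by simp
    show "\<forall>\<^sub>F n in sequentially. norm (pmf (cc_kernel Q S n n) n) \<le> 2 * S ^ n"
      using eventually_gt_at_top[of 0]
      by eventually_elim (simp add: cc_chain.return_le[OF chain])
  qed
  moreover have "\<forall>\<^sub>F n in sequentially. 1 - pmf (cc_kernel Q S n n) n = cc_mu Q S n / nu n"
    using eventually_gt_at_top[of 0]
  proof eventually_elim
    case (elim n)
    then show ?case
      using nu_pos[OF elim] cc_chain.cc_mu_eq[OF chain[OF elim]] by (simp add: nu_def)
  qed
  ultimately show ?thesis
    by (simp add: tendsto_cong)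
qed

lemma mu_pos: "\<forall>\<^sub>F n in sequentially. 0 < cc_mu Q S n"
  using order_tendstoD(1)[OF mu_over_nu zero_less_one] eventually_gt_at_top[of 0]
proof eventually_elim
  case (elim n)
  then show ?case
    using nu_pos[of n] by (simp add: zero_less_divide_iff)
qed

lemma mu_tendsto_0: "(\<lambda>n. cc_mu Q S n) \<longlonglongrightarrow> 0"
proof -
  have "(\<lambda>n. cc_mu Q S n / nu n * nu n) \<longlonglongrightarrow> 1 * 0"
    by (intro tendsto_mult mu_over_nu nu_tendsto_0)
  moreover have "\<forall>\<^sub>F n in sequentially. cc_mu Q S n / nu n * nu n = cc_mu Q S n"
    using eventually_gt_at_top[of 0]
  proof eventually_elim
    case (elim n)
    then show ?case using nu_pos[of n] by simp
  qed
  ultimately show ?thesis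
    by (simp add: tendsto_cong)
qed

text \<open>\<open>moment_step\<close> multiplied by \<open>nu n ^ Suc r\<close> compares
  consecutive orders; the constant \<open>K\<close> depends on \<open>r\<close> and \<open>S\<close>
  only, so \<open>S ^ (n - 1)\<close> sends the relative error to 0.\<close>

lemma nu_BB_tendsto: "(\<lambda>n. nu n ^ Suc r * BB n r) \<longlonglongrightarrow> 1"
proof (induction r)
  case 0
  show ?case
  proof (rule LIM_zero_cancel, rule Lim_null_comparison)
    show "(\<lambda>n. S ^ (n - 1) * renewal_sequence.const S) \<longlonglongrightarrow> 0"
      using tendsto_mult[OF S_pow_pred_tendsto tendsto_const] by simp
    show "\<forall>\<^sub>F n in sequentially. norm (nu n ^ Suc 0 * BB n 0 - 1) \<le> S ^ (n - 1) * renewal_sequence.const S"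
      using eventually_gt_at_top[of 0]
    proof eventually_elim
      case (elim n)
      interpret cc_chain Q S n by (rule chain[OF elim])
      show ?case using ren.B_0_close by (simp add: nu_def BB_def)
    qed
  qed
next
  case (Suc r)
  define K where "K = renewal_sequence.const S * (\<Sum>t. rising_weight r t * S ^ t)"
  have "(\<lambda>n. nu n ^ Suc (Suc r) * BB n (Suc r) - nu n ^ Suc r * BB n r) \<longlonglongrightarrow> 0"
  proof (rule Lim_null_comparison)
    show "(\<lambda>n. S ^ (n - 1) * K * (nu n ^ Suc r * BB n r)) \<longlonglongrightarrow> 0"
      using tendsto_mult[OF tendsto_mult[OF S_pow_pred_tendsto tendsto_const[of K]] Suc] by simp
    show "\<forall>\<^sub>F n in sequentially. norm (nu n ^ Suc (Suc r) * BB n (Suc r) - nu n ^ Suc r * BB n r)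
        \<le> S ^ (n - 1) * K * (nu n ^ Suc r * BB n r)"
      using eventually_gt_at_top[of 0]
    proof eventually_elim
      case (elim n)
      interpret cc_chain Q S n by (rule chain[OF elim])
      have "\<bar>nu n * BB n (Suc r) - BB n r\<bar> \<le> S ^ (n - 1) * K * BB n r"
        using ren.moment_step(2)[OF ren.summable_weight_h, of r]
        by (simp add: nu_def BB_def K_def mult_ac)
      then have "nu n ^ Suc r * \<bar>nu n * BB n (Suc r) - BB n r\<bar> \<le> nu n ^ Suc r * (S ^ (n - 1) * K * BB n r)"
        using nu_pos[OF elim] by (intro mult_left_mono) auto
      moreover have "nu n ^ Suc (Suc r) * BB n (Suc r) - nu n ^ Suc r * BB n r
          = nu n ^ Suc r * (nu n * BB n (Suc r) - BB n r)"
        by (simp add: algebra_simps)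
      ultimately show ?case
        using nu_pos[OF elim] by (simp add: abs_mult mult_ac)
    qed
  qed
  from tendsto_add[OF this Suc] show ?case by simp
qed

lemma nu_V_tendsto: "(\<lambda>n. nu n ^ r * cc_chain.V Q S n r) \<longlonglongrightarrow> fact r"
proof (cases r)
  case 0
  have "\<forall>\<^sub>F n in sequentially. nu n ^ r * cc_chain.V Q S n r = fact r"
    using eventually_gt_at_top[of 0]
    by eventually_elim (simp add: 0 cc_chain.V_0[OF chain])
  then show ?thesis by (rule tendsto_eventually)
next
  case (Suc l)
  have "(\<lambda>n. fact r * (nu n ^ r * BB n l)) \<longlonglongrightarrow> fact r * 1"
    unfolding Suc by (intro tendsto_mult tendsto_const nu_BB_tendsto)
  moreover have "\<forall>\<^sub>F n in sequentially. fact r * (nu n ^ r * BB n l) = nu n ^ r * cc_chain.V Q S n r"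
    using eventually_gt_at_top[of 0]
    by eventually_elim (simp add: Suc cc_chain.V_Suc[OF chain] BB_def mult_ac)
  ultimately show ?thesis by (simp add: tendsto_cong)
qed

lemma power_summable: "summable (\<lambda>t. real t ^ r * cc_T Q S n t)" if "0 < n" "1 \<le> r"
proof -
  interpret cc_chain Q S n by (rule chain[OF that(1)])
  obtain l where r: "r = Suc l" using \<open>1 \<le> r\<close> by (cases r) auto
  obtain C where "\<forall>x::real. x \<ge> 1 \<longrightarrow> 0 \<le> pochhammer x (Suc l) - x ^ Suc l \<and>
      pochhammer x (Suc l) - x ^ Suc l \<le> C * pochhammer x l"
    using pochhammer_minus_power[of l] by blast
  then show ?thesis
    unfolding r by (intro power_moment_bounds(1)[of l C]) blast
qed

text \<open>The correction \<open>C * V l\<close> has one order less, so after scaling it keeps a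
  spare factor \<open>nu n\<close> and vanishes.\<close>

lemma nu_M_tendsto: "(\<lambda>n. nu n ^ r * M n r) \<longlonglongrightarrow> fact r" if "1 \<le> r"
proof -
  obtain l where r: "r = Suc l" using \<open>1 \<le> r\<close> by (cases r) auto
  obtain C where C: "\<forall>x::real. x \<ge> 1 \<longrightarrow> 0 \<le> pochhammer x (Suc l) - x ^ Suc l \<and>
      pochhammer x (Suc l) - x ^ Suc l \<le> C * pochhammer x l"
    using pochhammer_minus_power[of l] by blast
  have bounds: "nu n ^ r * M n r \<le> nu n ^ r * cc_chain.V Q S n r \<and>
      nu n ^ r * cc_chain.V Q S n r - C * nu n * (nu n ^ l * cc_chain.V Q S n l) \<le> nu n ^ r * M n r"
    if n: "0 < n" for n
  proof -
    interpret cc_chain Q S n by (rule chain[OF n])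
    have "M n r \<le> V r" "V r - C * V l \<le> M n r"
      unfolding M_def r using power_moment_bounds(2,3)[of l C] C by blast+
    then have "nu n ^ r * M n r \<le> nu n ^ r * V r" "nu n ^ r * (V r - C * V l) \<le> nu n ^ r * M n r"
      using nu_pos[OF n] by (auto intro!: mult_left_mono)
    then show ?thesis by (simp add: r algebra_simps)
  qed
  have "(\<lambda>n. nu n ^ r * cc_chain.V Q S n r - C * nu n * (nu n ^ l * cc_chain.V Q S n l))
      \<longlonglongrightarrow> fact r - C * 0 * fact l"
    by (intro tendsto_diff tendsto_mult tendsto_const nu_V_tendsto nu_tendsto_0)
  then have lower: "(\<lambda>n. nu n ^ r * cc_chain.V Q S n r - C * nu n * (nu n ^ l * cc_chain.V Q S n l))
      \<longlonglongrightarrow> fact r" by simp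
  show ?thesis
  proof (rule tendsto_sandwich[OF _ _ lower nu_V_tendsto])
    show "\<forall>\<^sub>F n in sequentially. nu n ^ r * cc_chain.V Q S n r - C * nu n * (nu n ^ l * cc_chain.V Q S n l)
        \<le> nu n ^ r * M n r"
      "\<forall>\<^sub>F n in sequentially. nu n ^ r * M n r \<le> nu n ^ r * cc_chain.V Q S n r"
      by (rule eventually_mono[OF eventually_gt_at_top[of 0]], simp add: bounds)+
  qed
qed

lemma mu_M_tendsto: "(\<lambda>n. cc_mu Q S n ^ r * M n r) \<longlonglongrightarrow> fact r" if "1 \<le> r"
proof -
  have "(\<lambda>n. (cc_mu Q S n / nu n) ^ r * (nu n ^ r * M n r)) \<longlonglongrightarrow> 1 ^ r * fact r"
    by (intro tendsto_mult tendsto_power mu_over_nu nu_M_tendsto that)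
  moreover have "\<forall>\<^sub>F n in sequentially. (cc_mu Q S n / nu n) ^ r * (nu n ^ r * M n r) = cc_mu Q S n ^ r * M n r"
    using eventually_gt_at_top[of 0]
  proof eventually_elim
    case (elim n)
    then show ?case using nu_pos[OF elim] by (simp add: power_divide)
  qed
  ultimately show ?thesis by (simp add: tendsto_cong)
qed

definition A :: "nat \<Rightarrow> real" where
  "A n = 1 / qpoch_inf S * (fact n / real n ^ n) * Q ^ n * S ^ (n * (n + 1) div 2)"

lemma A_pos: "0 < A n" if "0 < n"
  using prod_one_minus_tendsto_qpoch(2)[OF S_pos S_less] Q_pos S_pos that by (simp add: A_def)

text \<open>By \<open>psi_eq\<close>, \<open>nu n\<close> is \<open>A n\<close> with the infinite
  product replaced by the finite product \<open>D n\<close>, which converges to it.\<close>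

lemma mu_over_A: "(\<lambda>n. cc_mu Q S n / A n) \<longlonglongrightarrow> 1"
proof -
  define D where "D n = (\<Prod>i=1..n. 1 - S ^ i * (1 - real i / real n))" for n
  note q = prod_one_minus_tendsto_qpoch[OF S_pos S_less]
  have "(\<lambda>n. cc_mu Q S n / nu n * (qpoch_inf S / D n)) \<longlonglongrightarrow> 1 * (qpoch_inf S / qpoch_inf S)"
    unfolding D_def using q(2) by (intro tendsto_mult tendsto_divide tendsto_const mu_over_nu q(1)) auto
  moreover have "\<forall>\<^sub>F n in sequentially. cc_mu Q S n / nu n * (qpoch_inf S / D n) = cc_mu Q S n / A n"
    using eventually_gt_at_top[of 0]
  proof eventually_elim
    case (elim n)
    have "nu n = A n * qpoch_inf S / D n"
      using cc_chain.psi_eq[OF chain[OF elim]] q(2) by (simp add: nu_def A_def D_def)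
    moreover from this have "D n \<noteq> 0" using nu_pos[OF elim] by auto
    ultimately show ?case using q(2) A_pos[OF elim] by (simp add: field_simps)
  qed
  ultimately show ?thesis using q(2) by (simp add: tendsto_cong)
qed

section \<open>Convergence in distribution\<close>

lemma cdf_eq:
  assumes "0 < cc_mu Q S n" "0 < n" "0 \<le> x"
  shows "(\<Sum>t. (if cc_mu Q S n * real t \<le> x then cc_T Q S n t else 0))
    = 1 - renewal_sequence.h (cc_T Q S n) (nat \<lfloor>x / cc_mu Q S n\<rfloor>)"
proof -
  interpret cc_chain Q S n by (rule chain[OF assms(2)])
  define N where "N = nat \<lfloor>x / cc_mu Q S n\<rfloor>"
  have iff: "cc_mu Q S n * real t \<le> x \<longleftrightarrow> t \<in> {..N}" for t
  proof -
    have "cc_mu Q S n * real t \<le> x \<longleftrightarrow> real t \<le> x / cc_mu Q S n"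
      using assms by (simp add: field_simps)
    also have "\<dots> \<longleftrightarrow> t \<in> {..N}"
      using assms by (simp add: N_def le_nat_iff le_floor_iff)
    finally show ?thesis .
  qed
  have "(\<Sum>t. (if cc_mu Q S n * real t \<le> x then cc_T Q S n t else 0)) = (\<Sum>t\<le>N. cc_T Q S n t)"
    unfolding iff by (subst suminf_finite[of "{..N}"]) auto
  then show ?thesis
    by (simp add: ren.h_def N_def)
qed

text \<open>Rounding down costs at most \<open>cc_mu\<close>, which tends to 0. The result is stated
  on the scale \<open>nu\<close> because the geometric comparison uses the stationary mass.\<close>

lemma floor_scaled_tendsto:
  assumes "0 \<le> x"
  shows "(\<lambda>n. nu n * real (nat \<lfloor>x / cc_mu Q S n\<rfloor>)) \<longlonglongrightarrow> x"
proof -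
  have "(\<lambda>n. cc_mu Q S n * real (nat \<lfloor>x / cc_mu Q S n\<rfloor>)) \<longlonglongrightarrow> x"
  proof (rule tendsto_sandwich[OF _ _ _ tendsto_const])
    show "(\<lambda>n. x - cc_mu Q S n) \<longlonglongrightarrow> x"
      using tendsto_diff[OF tendsto_const mu_tendsto_0, of x] by simp
    show "\<forall>\<^sub>F n in sequentially. x - cc_mu Q S n \<le> cc_mu Q S n * real (nat \<lfloor>x / cc_mu Q S n\<rfloor>)"
      using mu_pos
    proof eventually_elim
      case (elim n)
      have "x / cc_mu Q S n - 1 \<le> real (nat \<lfloor>x / cc_mu Q S n\<rfloor>)"
        by linarith
      then have "cc_mu Q S n * (x / cc_mu Q S n - 1) \<le> cc_mu Q S n * real (nat \<lfloor>x / cc_mu Q S n\<rfloor>)"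
        using elim by (intro mult_left_mono) auto
      then show ?case using elim by (simp add: right_diff_distrib)
    qed
    show "\<forall>\<^sub>F n in sequentially. cc_mu Q S n * real (nat \<lfloor>x / cc_mu Q S n\<rfloor>) \<le> x"
      using mu_pos
    proof eventually_elim
      case (elim n)
      have "real (nat \<lfloor>x / cc_mu Q S n\<rfloor>) \<le> x / cc_mu Q S n"
        using elim assms by (intro of_nat_floor) simp
      then have "cc_mu Q S n * real (nat \<lfloor>x / cc_mu Q S n\<rfloor>) \<le> cc_mu Q S n * (x / cc_mu Q S n)"
        using elim by (intro mult_left_mono) auto
      then show ?case using elim by simp
    qed
  qed
  then have "(\<lambda>n. (cc_mu Q S n * real (nat \<lfloor>x / cc_mu Q S n\<rfloor>)) / (cc_mu Q S n / nu n)) \<longlonglongrightarrow> x / 1"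
    by (intro tendsto_divide mu_over_nu) auto
  moreover have "\<forall>\<^sub>F n in sequentially. (cc_mu Q S n * real (nat \<lfloor>x / cc_mu Q S n\<rfloor>)) / (cc_mu Q S n / nu n)
      = nu n * real (nat \<lfloor>x / cc_mu Q S n\<rfloor>)"
    using mu_pos by eventually_elim simp
  ultimately show ?thesis by (simp add: tendsto_cong)
qed

lemma geometric_tail_tendsto:
  fixes N :: "nat \<Rightarrow> nat"
  assumes "(\<lambda>n. nu n * real (N n)) \<longlonglongrightarrow> x"
  shows "(\<lambda>n. (1 - nu n) ^ N n) \<longlonglongrightarrow> exp (- x)"
proof (rule tendsto_sandwich)
  \<comment> \<open>exp (- y / (1 - y)) \<le> 1 - y \<le> exp (- y) for y < 1\<close>
  have small: "\<forall>\<^sub>F n in sequentially. nu n < 1"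
    by (rule order_tendstoD(2)[OF nu_tendsto_0 zero_less_one])
  have "(\<lambda>n. exp (- (nu n * real (N n)) / (1 - nu n))) \<longlonglongrightarrow> exp (- x / (1 - 0))"
    by (intro tendsto_exp tendsto_divide tendsto_minus tendsto_diff tendsto_const nu_tendsto_0 assms) simp
  then show "(\<lambda>n. exp (- (nu n * real (N n)) / (1 - nu n))) \<longlonglongrightarrow> exp (- x)" by simp
  show "(\<lambda>n. exp (- (nu n * real (N n)))) \<longlonglongrightarrow> exp (- x)"
    by (intro tendsto_exp tendsto_minus assms)
  show "\<forall>\<^sub>F n in sequentially. exp (- (nu n * real (N n)) / (1 - nu n)) \<le> (1 - nu n) ^ N n"
    using small
  proof eventually_elim
    case (elim n)
    have "1 / (1 - nu n) = 1 + nu n / (1 - nu n)"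
      using elim by (simp add: field_simps)
    also have "\<dots> \<le> exp (nu n / (1 - nu n))"
      by (rule exp_ge_add_one_self)
    finally have "exp (- (nu n / (1 - nu n))) \<le> 1 - nu n"
      using elim by (simp add: exp_minus field_simps)
    then have "exp (- (nu n / (1 - nu n))) ^ N n \<le> (1 - nu n) ^ N n"
      by (intro power_mono) auto
    then show ?case
      by (simp add: mult.commute flip: exp_of_nat_mult)
  qed
  show "\<forall>\<^sub>F n in sequentially. (1 - nu n) ^ N n \<le> exp (- (nu n * real (N n)))"
    using small
  proof eventually_elim
    case (elim n)
    have "(1 - nu n) ^ N n \<le> exp (- nu n) ^ N n"
      using elim exp_ge_add_one_self[of "- nu n"] by (intro power_mono) auto
    then show ?case
      by (simp add: mult.commute flip: exp_of_nat_mult)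
  qed
qed

text \<open>The error growth is at most \<open>exp (nu n * real (N n))\<close>, which converges, so
  the prefactor \<open>S ^ (n - 1)\<close> decides.\<close>

lemma tail_tendsto:
  fixes N :: "nat \<Rightarrow> nat"
  assumes N: "(\<lambda>n. nu n * real (N n)) \<longlonglongrightarrow> x"
  shows "(\<lambda>n. renewal_sequence.h (cc_T Q S n) (N n)) \<longlonglongrightarrow> exp (- x)"
proof -
  have "(\<lambda>n. renewal_sequence.h (cc_T Q S n) (N n) - (1 - nu n) ^ N n) \<longlonglongrightarrow> 0"
  proof (rule Lim_null_comparison)
    have "(\<lambda>n. 3 * S ^ (n - 1) / (1 - S) * exp (nu n * real (N n))) \<longlonglongrightarrow> 3 * 0 / (1 - S) * exp x"
      using S_less by (intro tendsto_mult tendsto_divide tendsto_const tendsto_exp N S_pow_pred_tendsto) auto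
    then show "(\<lambda>n. 3 * S ^ (n - 1) / (1 - S) * exp (nu n * real (N n))) \<longlonglongrightarrow> 0" by simp
    show "\<forall>\<^sub>F n in sequentially. norm (renewal_sequence.h (cc_T Q S n) (N n) - (1 - nu n) ^ N n)
        \<le> 3 * S ^ (n - 1) / (1 - S) * exp (nu n * real (N n))"
      using eventually_gt_at_top[of 0]
    proof eventually_elim
      case (elim n)
      interpret cc_chain Q S n by (rule chain[OF elim])
      have "(1 + nu n) ^ N n \<le> exp (nu n) ^ N n"
        using nu_pos[OF elim] exp_ge_add_one_self[of "nu n"] by (intro power_mono) auto
      also have "\<dots> = exp (nu n * real (N n))"
        by (simp add: mult.commute flip: exp_of_nat_mult)
      finally have "3 * S ^ (n - 1) / (1 - S) * (1 + nu n) ^ N n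
          \<le> 3 * S ^ (n - 1) / (1 - S) * exp (nu n * real (N n))"
        using S_pos S_less by (intro mult_left_mono) auto
      then show ?case
        using ren.tail_geometric[of "N n"] unfolding nu_def real_norm_def by linarith
    qed
  qed
  from tendsto_add[OF this geometric_tail_tendsto[OF N]] show ?thesis by simp
qed

lemma cdf_tendsto:
  "(\<lambda>n. \<Sum>t. (if cc_mu Q S n * real t \<le> x then cc_T Q S n t else 0))
    \<longlonglongrightarrow> (if x < 0 then 0 else 1 - exp (- x))"
proof (cases "x < 0")
  case True
  have "\<forall>\<^sub>F n in sequentially. (\<Sum>t. (if cc_mu Q S n * real t \<le> x then cc_T Q S n t else 0)) = 0"
    using mu_pos
  proof eventually_elim
    case (elim n)
    have "\<not> cc_mu Q S n * real t \<le> x" for t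
      using mult_nonneg_nonneg[of "cc_mu Q S n" "real t"] elim True by linarith
    then show ?case by simp
  qed
  then show ?thesis
    using True by (simp add: tendsto_eventually)
next
  case False
  then have x: "0 \<le> x" by simp
  have "(\<lambda>n. 1 - renewal_sequence.h (cc_T Q S n) (nat \<lfloor>x / cc_mu Q S n\<rfloor>)) \<longlonglongrightarrow> 1 - exp (- x)"
    by (intro tendsto_diff tendsto_const tail_tendsto floor_scaled_tendsto x)
  moreover have "\<forall>\<^sub>F n in sequentially. 1 - renewal_sequence.h (cc_T Q S n) (nat \<lfloor>x / cc_mu Q S n\<rfloor>)
      = (\<Sum>t. (if cc_mu Q S n * real t \<le> x then cc_T Q S n t else 0))"
    using mu_pos eventually_gt_at_top[of 0] by eventually_elim (simp add: cdf_eq x)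
  ultimately show ?thesis
    using False by (simp add: tendsto_cong)
qed

end

theorem mainTheorem8:
  fixes \<alpha> \<beta> Q S :: real
  assumes "0 \<le> \<alpha>" "\<alpha> < 1" "0 < \<beta>" "\<beta> < 1"
    and "Q = 1 - \<alpha>" "S = 1 - \<beta>"
  shows "((\<lambda>n. cc_mu Q S n) \<sim>[at_top]
           (\<lambda>n. 1 / qpoch_inf S * (fact n / real n ^ n) * Q ^ n * S ^ (n * (n + 1) div 2))) \<and>
    (\<forall>x::real. (\<lambda>n. \<Sum>t. (if cc_mu Q S n * real t \<le> x then cc_T Q S n t else 0))
                     \<longlonglongrightarrow> (if x < 0 then 0 else 1 - exp (- x))) \<and>
    (\<forall>r::nat. r \<ge> 1 \<longrightarrow>
           (eventually (\<lambda>n. summable (\<lambda>t. (cc_mu Q S n * real t) ^ r * cc_T Q S n t)) at_top \<and>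
            (\<lambda>n. \<Sum>t. (cc_mu Q S n * real t) ^ r * cc_T Q S n t) \<longlonglongrightarrow> fact r)) \<and>
    ((\<lambda>n. \<Sum>t. real t * cc_T Q S n t) \<sim>[at_top]
           (\<lambda>n. qpoch_inf S * (real n ^ n / fact n) * Q powi (- int n)
                 * S powi (- int (n * (n + 1) div 2)))) \<and>
    ((\<lambda>n. (\<Sum>t. (real t)\<^sup>2 * cc_T Q S n t) - (\<Sum>t. real t * cc_T Q S n t)\<^sup>2) \<sim>[at_top]
           (\<lambda>n. (qpoch_inf S)\<^sup>2 * (real n ^ n / fact n)\<^sup>2 * Q powi (- 2 * int n)
                 * S powi (- int (n * (n + 1)))))"
proof -
  interpret cc_params Q S
    using assms by unfold_locales auto
  have A_inv: "1 / A n = qpoch_inf S * (real n ^ n / fact n) * Q powi (- int n) * S powi (- int (n * (n + 1) div 2))"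
    for n
  proof -
    have "Q powi (- int n) = 1 / Q ^ n" "S powi (- int (n * (n + 1) div 2)) = 1 / S ^ (n * (n + 1) div 2)"
      unfolding power_int_minus power_int_of_nat by (simp_all add: divide_inverse)
    then show ?thesis
      by (simp add: A_def)
  qed
  have A_inv_sq: "(1 / A n)\<^sup>2
      = (qpoch_inf S)\<^sup>2 * (real n ^ n / fact n)\<^sup>2 * Q powi (- 2 * int n) * S powi (- int (n * (n + 1)))" for n
  proof -
    have "- 2 * int n = - int (2 * n)" by simp
    then have Q: "Q powi (- 2 * int n) = (Q powi (- int n))\<^sup>2"
      by (simp only: power_int_minus power_int_of_nat power_even_eq power_inverse)
    \<comment> \<open>The product is even, so the integer division loses nothing and doubling the
      exponent is exact.\<close>
    have "n * (n + 1) = 2 * (n * (n + 1) div 2)"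
      by simp
    then have "S powi (- int (n * (n + 1))) = S powi (- int (2 * (n * (n + 1) div 2)))"
      by (rule arg_cong[of _ _ "\<lambda>m. S powi (- int m)"])
    also have "\<dots> = (S powi (- int (n * (n + 1) div 2)))\<^sup>2"
      by (simp only: power_int_minus power_int_of_nat power_even_eq power_inverse)
    finally show ?thesis
      unfolding A_inv Q by (simp only: power_mult_distrib)
  qed
  have scaled: "(\<lambda>t. (cc_mu Q S n * real t) ^ r * cc_T Q S n t)
      = (\<lambda>t. cc_mu Q S n ^ r * (real t ^ r * cc_T Q S n t))" for n r
    by (simp add: power_mult_distrib mult.assoc)
  have M1: "M n 1 = (\<Sum>t. real t * cc_T Q S n t)" for n
    by (simp add: M_def)
  have mu_asymp: "(\<lambda>n. cc_mu Q S n) \<sim>[at_top] A"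
    by (rule asymp_equivI'[OF mu_over_A])
  have moments: "(\<lambda>n. \<Sum>t. (cc_mu Q S n * real t) ^ r * cc_T Q S n t) \<longlonglongrightarrow> fact r"
    and moments_summable: "eventually (\<lambda>n. summable (\<lambda>t. (cc_mu Q S n * real t) ^ r * cc_T Q S n t)) at_top"
    if r: "r \<ge> 1" for r
  proof -
    show "eventually (\<lambda>n. summable (\<lambda>t. (cc_mu Q S n * real t) ^ r * cc_T Q S n t)) at_top"
      using eventually_gt_at_top[of 0]
      by eventually_elim (auto simp: scaled intro!: summable_mult power_summable r)
    have "\<forall>\<^sub>F n in sequentially. cc_mu Q S n ^ r * M n r = (\<Sum>t. (cc_mu Q S n * real t) ^ r * cc_T Q S n t)"
      using eventually_gt_at_top[of 0]
      by eventually_elim (simp add: scaled M_def suminf_mult[OF power_summable[OF _ r]])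
    then show "(\<lambda>n. \<Sum>t. (cc_mu Q S n * real t) ^ r * cc_T Q S n t) \<longlonglongrightarrow> fact r"
      using mu_M_tendsto[OF r] by (simp add: tendsto_cong)
  qed
  have mean: "(\<lambda>n. M n 1) \<sim>[at_top] (\<lambda>n. 1 / A n)"
  proof (rule asymp_equivI')
    have "(\<lambda>n. cc_mu Q S n ^ 1 * M n 1 / (cc_mu Q S n / A n)) \<longlonglongrightarrow> fact 1 / 1"
      by (intro tendsto_divide mu_M_tendsto mu_over_A) auto
    moreover have "\<forall>\<^sub>F n in sequentially. cc_mu Q S n ^ 1 * M n 1 / (cc_mu Q S n / A n) = M n 1 / (1 / A n)"
      using mu_pos by eventually_elim simp
    ultimately show "(\<lambda>n. M n 1 / (1 / A n)) \<longlonglongrightarrow> 1"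
      by (simp add: tendsto_cong)
  qed
  have variance: "(\<lambda>n. M n 2 - (M n 1)\<^sup>2) \<sim>[at_top] (\<lambda>n. (1 / A n)\<^sup>2)"
  proof (rule asymp_equivI')
    \<comment> \<open>The scaled second moment tends to 2 and the squared scaled mean to 1. The
      leading terms do not cancel, so no finer moment asymptotics are required.\<close>
    have "(\<lambda>n. (cc_mu Q S n ^ 2 * M n 2 - (cc_mu Q S n ^ 1 * M n 1)\<^sup>2) / (cc_mu Q S n / A n)\<^sup>2)
        \<longlonglongrightarrow> (fact 2 - (fact 1)\<^sup>2) / 1\<^sup>2"
      by (intro tendsto_divide tendsto_diff tendsto_power mu_M_tendsto mu_over_A) auto
    moreover have "\<forall>\<^sub>F n in sequentially.
        (cc_mu Q S n ^ 2 * M n 2 - (cc_mu Q S n ^ 1 * M n 1)\<^sup>2) / (cc_mu Q S n / A n)\<^sup>2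
        = (M n 2 - (M n 1)\<^sup>2) / (1 / A n)\<^sup>2"
      using mu_pos by eventually_elim
        (simp add: power_divide power_mult_distrib flip: right_diff_distrib)
    ultimately show "(\<lambda>n. (M n 2 - (M n 1)\<^sup>2) / (1 / A n)\<^sup>2) \<longlonglongrightarrow> 1"
      by (simp add: tendsto_cong)
  qed
  show ?thesis
    by (intro conjI allI impI mu_asymp[unfolded A_def[abs_def]] cdf_tendsto moments moments_summable
        mean[unfolded A_inv M1] variance[unfolded A_inv_sq M1, unfolded M_def])
qed

end
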